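(* Let $\mathsf{TDFSKL}$ be any TDF-SKL with domain sampler, with domain $\{0,1\}^{n(\lambda)}$ for a polynomial $n$. Then the PKE-SKL scheme $\mathsf{PKESKL}=(\mathsf{KG},\mathsf{Enc},\mathsf{Dec},\mathsf{Del},\mathsf{Vrfy})$ with message space $\{0,1\}$ built from $\mathsf{TDFSKL}$ by the construction given in the context is robust, i.e. $$\Pr_{(\mathsf{ek},\mathsf{dk},\mathsf{vk})\leftarrow\mathsf{KG}(1^\lambda)}\left[\forall\,\mathsf{ct},\ \mathrm{TD}(\mathsf{dk},\mathsf{dk}')\le\mathrm{negl}(\lambda)\right]\ge1-\mathrm{negl}(\lambda),$$ where $(\mu',\mathsf{dk}')\leftarrow\mathsf{Dec}(\mathsf{dk},\mathsf{ct})$ and the ciphertext $\mathsf{ct}$ ranges over arbitrary classical strings (not necessarily honestly generated).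
   Context: Conventions. $\lambda$ is the security parameter; PPT means classical probabilistic polynomial time and QPT quantum polynomial time; adversaries are non-uniform QPT. $\mathrm{negl}$ denotes an unspecified negligible function (not depending on $\mathsf{ct}$). Key generation algorithms with quantum output sample tuples consisting of classical strings and a quantum state, and probabilities over keys are over this sampling. $x\leftarrow S$ for a finite set $S$ means uniform sampling. $x\cdot r$ is the inner product of bit strings modulo 2. $\mathrm{TD}$ is trace distance $\frac12\|\cdot\|_1$. In the robustness condition $\mathsf{dk}'$ denotes the state of the decryption key after decryption (the reduced state of the key register, i.e. averaged over the output $\mu'$). TDF-SKL with domain sampler (domain $\{0,1\}^{n(\lambda)}$). A tuple $(\mathsf{TDF.KG},\mathsf{TDF.Samp},\mathsf{TDF.Eval},\mathsf{TDF.Inv},\mathsf{TDF.Del},\mathsf{TDF.Vrfy})$ of efficient algorithms: QPT $\mathsf{TDF.KG}(1^\lambda)\to(\mathsf{ek},\mathsf{td},\mathsf{vk})$ with $\mathsf{ek},\mathsf{vk}$ classical and $\mathsf{td}$ a quantum state; PPT $\mathsf{TDF.Samp}(\mathsf{ek})\to x\in\{0,1\}^{n(\lambda)}$; classical deterministic $\mathsf{TDF.Eval}(\mathsf{ek},x)\to y$; QPT $\mathsf{TDF.Inv}(\mathsf{td},y)\to(x',\mathsf{td}')$; QPT $\mathsf{TDF.Del}(\mathsf{td})\to\mathsf{cert}$ (classical); deterministic $\mathsf{TDF.Vrfy}(\mathsf{vk},\mathsf{cert})\to\top/\bot$. Requirements: - Almost-all-keys inversion correctness: with probability $\ge1-\mathrm{negl}(\lambda)$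 over the keys, for all $x\in\{0,1\}^{n(\lambda)}$, $\mathsf{TDF.Inv}(\mathsf{td},\mathsf{TDF.Eval}(\mathsf{ek},x))$ outputs $x$ with probability $\ge1-\mathrm{negl}(\lambda)$. - Deletion verification correctness: $\Pr[\mathsf{TDF.Vrfy}(\mathsf{vk},\mathsf{TDF.Del}(\mathsf{td}))=\top]\ge1-\mathrm{negl}(\lambda)$. - OW-VRA security: every QPT $A$ wins the following game with probability at most $\mathrm{negl}(\lambda)$: the challenger samples $(\mathsf{ek},\mathsf{td},\mathsf{vk})\leftarrow\mathsf{TDF.KG}(1^\lambda)$ and sends $(\mathsf{ek},\mathsf{td})$ to $A$; $A$ sends $\mathsf{cert}$; if $\mathsf{TDF.Vrfy}(\mathsf{vk},\mathsf{cert})=\bot$, $A$ loses; otherwise the challenger samples $x\leftarrow\mathsf{TDF.Samp}(\mathsf{ek})$ and sends $(\mathsf{TDF.Eval}(\mathsf{ek},x),\mathsf{vk})$; $A$ sends $x'$ and wins iff $x'=x$. Construction of $\mathsf{PKESKL}$. - $\mathsf{KG}(1^\lambda)$: run $(\mathsf{ek}_T,\mathsf{td}_T,\mathsf{vk}_T)\leftarrow\mathsf{TDF.KG}(1^\lambda)$; return $\mathsf{ek}=\mathsf{ek}_T$, $\mathsf{dk}=(\mathsf{ek}_T,\mathsf{td}_T)$, $\mathsf{vk}=\mathsf{vk}_T$. - $\mathsf{Enc}(\mathsf{ek},\mu)$, $\mu\in\{0,1\}$: sample $r\leftarrow\{0,1\}^{n(\lambda)}$, $x\leftarrow\mathsf{TDF.Samp}(\mathsf{ek}_T)$;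 set $y=\mathsf{TDF.Eval}(\mathsf{ek}_T,x)$, $b=(x\cdot r)\oplus\mu$; return $\mathsf{ct}=(y,r,b)$. - $\mathsf{Dec}(\mathsf{dk},\mathsf{ct})$: (1) if $\mathsf{ct}$ does not parse as $(y,r,b)$ with $r\in\{0,1\}^{n(\lambda)}$, $b\in\{0,1\}$, output $(\bot,\mathsf{dk})$. (2) Coherently apply the unitary implementation of $\mathsf{TDF.Inv}(\mathsf{td}_T,y)$ (with ancillas initialized to $|0\rangle$) to obtain a preimage register $x'$, and compute in a result register $(x'\cdot r)\oplus b$ if $\mathsf{TDF.Eval}(\mathsf{ek}_T,x')=y$ and $\bot$ otherwise. (3) Copy the result register (in the computational basis) into an ancilla register and uncompute step (2). (4) Measure the ancilla to obtain $\mu'$; let $\mathsf{td}_T'$ be the resulting state of the original trapdoor register; output $(\mu',(\mathsf{ek}_T,\mathsf{td}_T'))$. - $\mathsf{Del}(\mathsf{dk})=\mathsf{TDF.Del}(\mathsf{td}_T)$; $\mathsf{Vrfy}(\mathsf{vk},\mathsf{cert})=\mathsf{TDF.Vrfy}(\mathsf{vk}_T,\mathsf{cert})$. *)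

theory Defs
  imports
    "HOL-Probability.Probability_Mass_Function"
    "HOL-Computational_Algebra.Polynomial_Factorial"
    "Jordan_Normal_Form.Schur_Decomposition"
begin

hide_const (open) Finite_Cartesian_Product.mat Determinants.trace Coset.order

text \<open>Security parameters are written \<^term>\<open>k\<close>. Strings are lists of bits.\<close>

section \<open>Efficient classical computation\<close>

text \<open>
  Single-tape deterministic Turing machines with a two-way infinite tape. States and tape
  symbols are natural numbers; a machine is a finite list of rules
  ((state, read), (new state, written, move right?)), and it halts when no rule applies. State 0 is
  initial and symbol 0 is the blank.
\<close>

type_synonym tm = "((nat \<times> nat) \<times> (nat \<times> nat \<times> bool)) list"
type_synonym tm_config = "nat \<times> int \<times> (int \<Rightarrow> nat)"

definition tm_halted :: "tm \<Rightarrow> tm_config \<Rightarrow> bool" where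
  "tm_halted M = (\<lambda>(q, p, tape). map_of M (q, tape p) = None)"

definition tm_step :: "tm \<Rightarrow> tm_config \<Rightarrow> tm_config" where
  "tm_step M = (\<lambda>(q, p, tape).
     case map_of M (q, tape p) of
       None \<Rightarrow> (q, p, tape)
     | Some (q', s, right) \<Rightarrow> (q', if right then p + 1 else p - 1, tape(p := s)))"

definition tm_init :: "nat list \<Rightarrow> tm_config" where
  "tm_init w = (0, 0, \<lambda>p. if 0 \<le> p \<and> p < int (length w) then w ! nat p else 0)"

text \<open>The output is the word between the final head position and the next blank to its right.\<close>

definition tm_computes_within :: "tm \<Rightarrow> nat list \<Rightarrow> nat \<Rightarrow> nat list \<Rightarrow> bool" where
  "tm_computes_within M w t v \<longleftrightarrow>
     (case (tm_step M ^^ t) (tm_init w) of (q, p, tape) \<Rightarrow>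
        tm_halted M (q, p, tape) \<and>
        (\<forall>i < length v. tape (p + int i) = v ! i) \<and> tape (p + int (length v)) = 0)"

text \<open>Tuples of bit strings are written on the tape with an end marker 3 after each component.\<close>

definition tape_word :: "bool list list \<Rightarrow> nat list" where
  "tape_word ws = concat (map (\<lambda>w. map (\<lambda>b. if b then 2 else 1) w @ [3]) ws)"

definition poly_time ::
  "'a set \<Rightarrow> ('a \<Rightarrow> bool list list) \<Rightarrow> ('a \<Rightarrow> bool list list) \<Rightarrow> bool" where
  "poly_time S inp out \<longleftrightarrow>
     (\<exists>M c. \<forall>a\<in>S. tm_computes_within M (tape_word (inp a))
                    (length (tape_word (inp a)) ^ c + c) (tape_word (out a)))"

definition unary :: "nat \<Rightarrow> bool list" where
  "unary m = replicate m True"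

text \<open>Since both sides are in unary, this forces \<^term>\<open>f\<close> to be polynomially bounded.\<close>

definition poly_length :: "(nat \<Rightarrow> nat) \<Rightarrow> bool" where
  "poly_length f \<longleftrightarrow> poly_time UNIV (\<lambda>k. [unary k]) (\<lambda>k. [unary (f k)])"

definition negligible :: "(nat \<Rightarrow> real) \<Rightarrow> bool" where
  "negligible f \<longleftrightarrow> (\<forall>c::nat. \<forall>\<^sub>F k in sequentially. \<bar>f k\<bar> < 1 / real k ^ c)"

definition uniform_string :: "nat \<Rightarrow> bool list pmf" where
  "uniform_string m = pmf_of_set {s. length s = m}"

definition ip :: "bool list \<Rightarrow> bool list \<Rightarrow> bool" where
  "ip x r \<longleftrightarrow> odd (length (filter (\<lambda>(a, b). a \<and> b) (zip x r)))"


section \<open>States of qubits\<close>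

text \<open>
  A state of \<open>m\<close> qubits is a density operator, given as a \<open>2 ^ m\<close> by \<open>2 ^ m\<close> matrix. Wires are
  numbered from 0, and wire \<open>q\<close> is bit \<open>q\<close> of the index of a computational basis vector (least
  significant bit first). Accordingly \<open>tensor A B\<close> puts \<open>A\<close> on the lower-numbered wires.
\<close>

definition tensor :: "complex mat \<Rightarrow> complex mat \<Rightarrow> complex mat" where
  "tensor A B = mat (dim_row A * dim_row B) (dim_col A * dim_col B)
     (\<lambda>(i, j). A $$ (i mod dim_row A, j mod dim_col A) * B $$ (i div dim_row A, j div dim_col A))"

definition basis_state :: "bool list \<Rightarrow> complex mat" where
  "basis_state s = mat (2 ^ length s) (2 ^ length s)
     (\<lambda>(i, j). of_bool (i = horner_sum of_bool 2 s \<and> j = horner_sum of_bool 2 s))"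

definition zero_state :: "nat \<Rightarrow> complex mat" where
  "zero_state m = basis_state (replicate m False)"

definition evolve :: "complex mat \<Rightarrow> complex mat \<Rightarrow> complex mat" where
  "evolve U \<rho> = U * \<rho> * mat_adjoint U"

text \<open>Partial trace: the reduced state of the wires below \<^term>\<open>m\<close>.\<close>

definition reduced :: "nat \<Rightarrow> complex mat \<Rightarrow> complex mat" where
  "reduced m \<rho> = mat (2 ^ m) (2 ^ m)
     (\<lambda>(i, j). \<Sum>l < dim_row \<rho> div 2 ^ m. \<rho> $$ (i + 2 ^ m * l, j + 2 ^ m * l))"

definition mtrace :: "complex mat \<Rightarrow> complex" where
  "mtrace A = (\<Sum>i < dim_row A. A $$ (i, i))"

definition outcome_proj :: "nat \<Rightarrow> nat list \<Rightarrow> bool list \<Rightarrow> complex mat" where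
  "outcome_proj d qs s = mat d d (\<lambda>(i, j). of_bool (i = j \<and> map (bit i) qs = s))"

text \<open>
  Measurement of the wires \<^term>\<open>qs\<close> in the computational basis, by the Born rule: the outcome and
  the normalized post-measurement state of all wires. (The density passed to \<^const>\<open>embed_pmf\<close>
  sums to 1 whenever \<^term>\<open>\<rho>\<close> is a density operator.)
\<close>

definition measure_wires :: "nat list \<Rightarrow> complex mat \<Rightarrow> (bool list \<times> complex mat) pmf" where
  "measure_wires qs \<rho> =
     (let P = outcome_proj (dim_row \<rho>) qs; prob = (\<lambda>s. Re (mtrace (P s * \<rho> * P s)))
      in map_pmf (\<lambda>s. (s, complex_of_real (1 / prob s) \<cdot>\<^sub>m (P s * \<rho> * P s))) (embed_pmf prob))"

text \<open>The Schatten 1-norm: the sum of the singular values of \<^term>\<open>A\<close>, with multiplicity.\<close>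

definition trace_norm :: "complex mat \<Rightarrow> real" where
  "trace_norm A = (\<Sum>e\<in>#proots (char_poly (mat_adjoint A * A)). sqrt (Re e))"

definition trace_distance :: "complex mat \<Rightarrow> complex mat \<Rightarrow> real" where
  "trace_distance \<rho> \<sigma> = trace_norm (\<rho> - \<sigma>) / 2"


section \<open>Quantum circuits\<close>

datatype gate = Hadamard nat | TGate nat | CNot nat nat

datatype circuit = Circuit (width: nat) (gates: "gate list")

fun gate_ok :: "nat \<Rightarrow> gate \<Rightarrow> bool" where
  "gate_ok N (Hadamard q) \<longleftrightarrow> q < N"
| "gate_ok N (TGate q) \<longleftrightarrow> q < N"
| "gate_ok N (CNot p q) \<longleftrightarrow> p < N \<and> q < N \<and> p \<noteq> q"

definition circuit_ok :: "circuit \<Rightarrow> bool" where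
  "circuit_ok C \<longleftrightarrow> (\<forall>g \<in> set (gates C). gate_ok (width C) g)"

definition perm_mat :: "nat \<Rightarrow> (nat \<Rightarrow> nat) \<Rightarrow> complex mat" where
  "perm_mat N \<pi> = mat (2 ^ N) (2 ^ N) (\<lambda>(i, j). of_bool (i = \<pi> j))"

fun gate_mat :: "nat \<Rightarrow> gate \<Rightarrow> complex mat" where
  "gate_mat N (Hadamard q) = mat (2 ^ N) (2 ^ N)
     (\<lambda>(i, j). if unset_bit q i = unset_bit q j
              then (if bit i q \<and> bit j q then - 1 else 1) / complex_of_real (sqrt 2) else 0)"
| "gate_mat N (TGate q) = mat (2 ^ N) (2 ^ N)
     (\<lambda>(i, j). if i = j then (if bit i q then cis (pi / 4) else 1) else 0)"
| "gate_mat N (CNot p q) = perm_mat N (\<lambda>j. if bit j p then flip_bit q j else j)"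

text \<open>The first gate of the list acts first.\<close>

definition gates_mat :: "nat \<Rightarrow> gate list \<Rightarrow> complex mat" where
  "gates_mat N gs = fold (\<lambda>g U. gate_mat N g * U) gs (1\<^sub>m (2 ^ N))"

text \<open>The input occupies the first \<^term>\<open>m\<close> wires; all other wires start in state 0.\<close>

definition run_circuit :: "circuit \<Rightarrow> nat \<Rightarrow> complex mat \<Rightarrow> complex mat" where
  "run_circuit C m \<rho> =
     evolve (gates_mat (width C) (gates C)) (tensor \<rho> (zero_state (width C - m)))"

fun encode_gate :: "gate \<Rightarrow> bool list list" where
  "encode_gate (Hadamard q) = [[False, False], unary q]"
| "encode_gate (TGate q) = [[False, True], unary q]"
| "encode_gate (CNot p q) = [[True, True], unary p, unary q]"

definition encode_circuit :: "circuit \<Rightarrow> bool list list" where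
  "encode_circuit C = unary (width C) # concat (map encode_gate (gates C))"

definition circuit_size :: "circuit \<Rightarrow> nat" where
  "circuit_size C = width C + length (gates C)"


section \<open>TDF-SKL with domain sampler\<close>

text \<open>
  Quantum algorithms are circuits written down by a polynomial-time Turing machine from the
  security parameter (in unary) and the classical input; their measurements are deferred to the
  end. Key generation measures an encryption key, a verification key and auxiliary wires whose
  outcome is discarded; so the sampled trapdoor state may depend on more randomness than
  the two classical keys reveal. PPT sampling is deterministic polynomial-time computation on
  uniform coins. All algorithms receive the security parameter.
\<close>

record tdf =
  dom_len :: "nat \<Rightarrow> nat"
  coin_len :: "nat \<Rightarrow> nat"
  ek_len :: "nat \<Rightarrow> nat"
  vk_len :: "nat \<Rightarrow> nat"
  aux_len :: "nat \<Rightarrow> nat"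
  td_len :: "nat \<Rightarrow> nat"
  cert_len :: "nat \<Rightarrow> nat"
  kg_circ :: "nat \<Rightarrow> circuit"
  inv_circ :: "nat \<Rightarrow> bool list \<Rightarrow> circuit"
  del_circ :: "nat \<Rightarrow> circuit"
  samp_fun :: "nat \<Rightarrow> bool list \<Rightarrow> bool list \<Rightarrow> bool list"
  tdf_eval :: "nat \<Rightarrow> bool list \<Rightarrow> bool list \<Rightarrow> bool list"
  tdf_vrfy :: "nat \<Rightarrow> bool list \<Rightarrow> bool list \<Rightarrow> bool"

definition tdf_efficient :: "tdf \<Rightarrow> bool" where
  "tdf_efficient F \<longleftrightarrow>
     poly_length (dom_len F) \<and> poly_length (coin_len F) \<and> poly_length (ek_len F) \<and>
     poly_length (vk_len F) \<and> poly_length (aux_len F) \<and> poly_length (td_len F) \<and>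
     poly_length (cert_len F) \<and>
     poly_time UNIV (\<lambda>k. [unary k]) (\<lambda>k. encode_circuit (kg_circ F k)) \<and>
     poly_time UNIV (\<lambda>(k, y). [unary k, y]) (\<lambda>(k, y). encode_circuit (inv_circ F k y)) \<and>
     poly_time UNIV (\<lambda>k. [unary k]) (\<lambda>k. encode_circuit (del_circ F k)) \<and>
     poly_time {(k, ek, c). length ek = ek_len F k \<and> length c = coin_len F k}
       (\<lambda>(k, ek, c). [unary k, ek, c]) (\<lambda>(k, ek, c). [samp_fun F k ek c]) \<and>
     poly_time {(k, ek, x). length ek = ek_len F k \<and> length x = dom_len F k}
       (\<lambda>(k, ek, x). [unary k, ek, x]) (\<lambda>(k, ek, x). [tdf_eval F k ek x]) \<and>
     poly_time {(k, vk, cert). length vk = vk_len F k \<and> length cert = cert_len F k}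
       (\<lambda>(k, vk, cert). [unary k, vk, cert]) (\<lambda>(k, vk, cert). [[tdf_vrfy F k vk cert]])"

definition tdf_well_formed :: "tdf \<Rightarrow> bool" where
  "tdf_well_formed F \<longleftrightarrow>
     (\<forall>k. circuit_ok (kg_circ F k) \<and>
          td_len F k + ek_len F k + vk_len F k + aux_len F k \<le> width (kg_circ F k)) \<and>
     (\<forall>k y. circuit_ok (inv_circ F k y) \<and> td_len F k + dom_len F k \<le> width (inv_circ F k y)) \<and>
     (\<forall>k. circuit_ok (del_circ F k) \<and> td_len F k + cert_len F k \<le> width (del_circ F k)) \<and>
     (\<forall>k ek c. length ek = ek_len F k \<longrightarrow> length c = coin_len F k \<longrightarrow>
          length (samp_fun F k ek c) = dom_len F k)"

definition tdf_kg :: "tdf \<Rightarrow> nat \<Rightarrow> (bool list \<times> complex mat \<times> bool list) pmf" where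
  "tdf_kg F k =
     (let t = td_len F k; e = ek_len F k; v = vk_len F k; a = aux_len F k
      in map_pmf (\<lambda>(s, \<rho>). (take e s, reduced t \<rho>, take v (drop e s)))
           (measure_wires [t ..< t + e + v + a] (run_circuit (kg_circ F k) 0 (zero_state 0))))"

definition tdf_samp :: "tdf \<Rightarrow> nat \<Rightarrow> bool list \<Rightarrow> bool list pmf" where
  "tdf_samp F k ek = map_pmf (samp_fun F k ek) (uniform_string (coin_len F k))"

definition tdf_inv :: "tdf \<Rightarrow> nat \<Rightarrow> complex mat \<Rightarrow> bool list \<Rightarrow> (bool list \<times> complex mat) pmf" where
  "tdf_inv F k td y =
     (let t = td_len F k
      in map_pmf (\<lambda>(x, \<rho>). (x, reduced t \<rho>))
           (measure_wires [t ..< t + dom_len F k] (run_circuit (inv_circ F k y) t td)))"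

definition tdf_del :: "tdf \<Rightarrow> nat \<Rightarrow> complex mat \<Rightarrow> bool list pmf" where
  "tdf_del F k td =
     (let t = td_len F k
      in map_pmf fst (measure_wires [t ..< t + cert_len F k] (run_circuit (del_circ F k) t td)))"

definition inversion_correct :: "tdf \<Rightarrow> bool" where
  "inversion_correct F \<longleftrightarrow>
     (\<exists>\<epsilon> \<delta>. negligible \<epsilon> \<and> negligible \<delta> \<and>
        (\<forall>k. measure_pmf.prob (tdf_kg F k)
               {(ek, td, vk). \<forall>x. length x = dom_len F k \<longrightarrow>
                  measure_pmf.prob (tdf_inv F k td (tdf_eval F k ek x)) {(x', td'). x' = x}
                    \<ge> 1 - \<epsilon> k}
             \<ge> 1 - \<delta> k))"

definition deletion_correct :: "tdf \<Rightarrow> bool" where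
  "deletion_correct F \<longleftrightarrow>
     (\<exists>\<epsilon>. negligible \<epsilon> \<and>
        (\<forall>k. pmf (do { (ek, td, vk) \<leftarrow> tdf_kg F k;
                       cert \<leftarrow> tdf_del F k td;
                       return_pmf (tdf_vrfy F k vk cert) }) True \<ge> 1 - \<epsilon> k))"

text \<open>
  A non-uniform adversary consists of two families of polynomial-size circuits. The first one is
  given the wires of \<open>td\<close> and \<open>ek\<close> and produces the certificate on the wires that follow; all its
  wires are passed to the second one, together with \<open>y\<close> and \<open>vk\<close>. The second family is also
  indexed by the length of \<open>y\<close>.
\<close>

record adversary =
  adv1 :: "nat \<Rightarrow> circuit"
  adv2 :: "nat \<Rightarrow> nat \<Rightarrow> circuit"

definition adversary_ok :: "tdf \<Rightarrow> adversary \<Rightarrow> bool" where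
  "adversary_ok F A \<longleftrightarrow>
     (\<forall>k. circuit_ok (adv1 A k) \<and>
          td_len F k + ek_len F k + cert_len F k \<le> width (adv1 A k)) \<and>
     (\<forall>k m. circuit_ok (adv2 A k m) \<and>
          width (adv1 A k) + m + vk_len F k + dom_len F k \<le> width (adv2 A k m)) \<and>
     (\<exists>c. (\<forall>k. circuit_size (adv1 A k) \<le> k ^ c + c) \<and>
          (\<forall>k m. circuit_size (adv2 A k m) \<le> (k + m) ^ c + c))"

definition ow_vra_game :: "tdf \<Rightarrow> adversary \<Rightarrow> nat \<Rightarrow> bool pmf" where
  "ow_vra_game F A k = do {
     (ek, td, vk) \<leftarrow> tdf_kg F k;
     let i1 = td_len F k + ek_len F k;
     (cert, st) \<leftarrow> measure_wires [i1 ..< i1 + cert_len F k]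
                     (run_circuit (adv1 A k) i1 (tensor td (basis_state ek)));
     if \<not> tdf_vrfy F k vk cert then return_pmf False
     else do {
       x \<leftarrow> tdf_samp F k ek;
       let y = tdf_eval F k ek x;
       let i2 = width (adv1 A k) + length y + vk_len F k;
       (x', _) \<leftarrow> measure_wires [i2 ..< i2 + dom_len F k]
                   (run_circuit (adv2 A k (length y)) i2
                     (tensor st (tensor (basis_state y) (basis_state vk))));
       return_pmf (x' = x)
     }
   }"

definition ow_vra_secure :: "tdf \<Rightarrow> bool" where
  "ow_vra_secure F \<longleftrightarrow>
     (\<forall>A. adversary_ok F A \<longrightarrow>
        (\<exists>\<epsilon>. negligible \<epsilon> \<and> (\<forall>k. pmf (ow_vra_game F A k) True \<le> \<epsilon> k)))"

definition tdf_skl :: "tdf \<Rightarrow> bool" where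
  "tdf_skl F \<longleftrightarrow>
     tdf_well_formed F \<and> tdf_efficient F \<and>
     inversion_correct F \<and> deletion_correct F \<and> ow_vra_secure F"


section \<open>PKE-SKL and robustness\<close>

text \<open>A decryption key is a classical string together with a quantum state.\<close>

type_synonym dkey = "bool list \<times> complex mat"

record pke_skl =
  pke_kg :: "nat \<Rightarrow> (bool list \<times> dkey \<times> bool list) pmf"
  pke_enc :: "nat \<Rightarrow> bool list \<Rightarrow> bool \<Rightarrow> bool list pmf"
  pke_dec :: "nat \<Rightarrow> dkey \<Rightarrow> bool list \<Rightarrow> (bool option \<times> dkey) pmf"
  pke_del :: "nat \<Rightarrow> dkey \<Rightarrow> bool list pmf"
  pke_vrfy :: "nat \<Rightarrow> bool list \<Rightarrow> bool list \<Rightarrow> bool"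

definition dk_state :: "dkey \<Rightarrow> complex mat" where
  "dk_state = (\<lambda>(s, \<rho>). tensor (basis_state s) \<rho>)"

text \<open>The state of the key register after decryption, averaged over the plaintext.\<close>

definition dk_after :: "pke_skl \<Rightarrow> nat \<Rightarrow> dkey \<Rightarrow> bool list \<Rightarrow> complex mat" where
  "dk_after S k dk ct = mat (dim_row (dk_state dk)) (dim_col (dk_state dk))
     (\<lambda>(i, j). measure_pmf.expectation (pke_dec S k dk ct) (\<lambda>(\<mu>, dk'). dk_state dk' $$ (i, j)))"

definition robust :: "pke_skl \<Rightarrow> bool" where
  "robust S \<longleftrightarrow>
     (\<exists>\<epsilon> \<delta>. negligible \<epsilon> \<and> negligible \<delta> \<and>
        (\<forall>k. measure_pmf.prob (pke_kg S k)
               {(ek, dk, vk). \<forall>ct. trace_distance (dk_state dk) (dk_after S k dk ct) \<le> \<epsilon> k}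
             \<ge> 1 - \<delta> k))"


section \<open>The construction\<close>

definition kg :: "tdf \<Rightarrow> nat \<Rightarrow> (bool list \<times> dkey \<times> bool list) pmf" where
  "kg F k = do { (ek, td, vk) \<leftarrow> tdf_kg F k; return_pmf (ek, (ek, td), vk) }"

text \<open>A ciphertext \<open>(y, r, b)\<close> is the string \<open>y @ r @ [b]\<close>, and is parsed from its end.\<close>

definition enc :: "tdf \<Rightarrow> nat \<Rightarrow> bool list \<Rightarrow> bool \<Rightarrow> bool list pmf" where
  "enc F k ek \<mu> = do {
     r \<leftarrow> uniform_string (dom_len F k);
     x \<leftarrow> tdf_samp F k ek;
     let y = tdf_eval F k ek x;
     let b = (ip x r \<noteq> \<mu>);
     return_pmf (y @ r @ [b])
   }"

definition parse_ct :: "nat \<Rightarrow> bool list \<Rightarrow> (bool list \<times> bool list \<times> bool) option" where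
  "parse_ct n ct =
     (if length ct < n + 1 then None
      else let m = length ct - (n + 1) in Some (take m ct, take n (drop m ct), last ct))"

text \<open>
  The result register consists of the wires \<open>w\<close> and \<open>w + 1\<close>: the first one is set iff the result is
  not \<open>\<bottom>\<close>, the second one then holds the bit. The permutation adds the result to the register.
\<close>

definition result_perm ::
  "tdf \<Rightarrow> nat \<Rightarrow> bool list \<Rightarrow> bool list \<times> bool list \<times> bool \<Rightarrow> nat \<Rightarrow> nat \<Rightarrow> nat" where
  "result_perm F k ek = (\<lambda>(y, r, b) w i.
     let x' = map (bit i) [td_len F k ..< td_len F k + dom_len F k]
     in if tdf_eval F k ek x' = y
        then flip_bit w (if ip x' r \<noteq> b then flip_bit (w + 1) i else i)
        else i)"

definition decode_result :: "bool list \<Rightarrow> bool option" where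
  "decode_result s = (if s ! 0 then Some (s ! 1) else None)"

text \<open>Wires: those of the inversion circuit, then the result register, then its copy.\<close>

definition dec :: "tdf \<Rightarrow> nat \<Rightarrow> dkey \<Rightarrow> bool list \<Rightarrow> (bool option \<times> dkey) pmf" where
  "dec F k = (\<lambda>(ek, td) ct.
     case parse_ct (dom_len F k) ct of
       None \<Rightarrow> return_pmf (None, (ek, td))
     | Some (y, r, b) \<Rightarrow>
         let t = td_len F k;
             C = inv_circ F k y;
             w = width C;
             V = perm_mat (w + 4) (result_perm F k ek (y, r, b) w) * gates_mat (w + 4) (gates C);
             copy = gates_mat (w + 4) [CNot w (w + 2), CNot (w + 1) (w + 3)];
             \<sigma> = evolve (mat_adjoint V * copy * V) (tensor td (zero_state (w + 4 - t)))
         in map_pmf (\<lambda>(s, \<rho>). (decode_result s, (ek, reduced t \<rho>)))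
              (measure_wires [w + 2, w + 3] \<sigma>))"

definition pke_of_tdf :: "tdf \<Rightarrow> pke_skl" where
  "pke_of_tdf F = \<lparr>
     pke_kg = kg F,
     pke_enc = enc F,
     pke_dec = dec F,
     pke_del = (\<lambda>k (ek, td). tdf_del F k td),
     pke_vrfy = tdf_vrfy F \<rparr>"

end

theory Submission
  imports Defs
begin

text \<open>
  A fixed trapdoor state is \<open>L L*\<close>, with \<open>L\<close> of Frobenius norm 1. If \<open>y = Eval(ek, x)\<close>, the inversion
  circuit produces \<open>x\<close> except on a part of \<open>L\<close> of squared norm at most the inversion error
  \<open>\<epsilon>\<close>; if \<open>y\<close> has no preimage, the result is always \<open>\<bottom>\<close>. So, up to norm
  \<open>2 \<surd>\<epsilon>\<close>, copying the result adds a fixed mask to the copy wires. This mask commutes with the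
  unitary that is uncomputed and disappears in the partial trace, hence in the ideal case the key is
  unchanged. The final measurement only touches wires that are traced out. The distance of the
  factors bounds the trace distance by Cauchy-Schwarz in an eigenbasis of the difference.
\<close>

section \<open>Adjoints, unitaries and diagonalization of Hermitian matrices\<close>

unbundle no vec_syntax

text \<open>The ciphertext is arbitrary, whereas the inversion guarantee speaks only of images of
  \<open>tdf_eval\<close>; closing this gap is the purpose of the re-evaluation in decryption. The
  argument is a gentle-measurement argument, but it is carried out on factors rather than on density
  operators: the columns of \<open>L\<close> play the role of a purifying environment, so mixed
  trapdoor states are treated like pure ones and all errors live in one Euclidean norm. Any factors
  with the right partial traces may be compared, which is why the ideal run is allowed to differ
  from the untouched key on discarded wires. The constant 2 arises because the bad part passes once
  through the ideal mask and once through the real copy. Comparing Gram matrices costs another 2,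
  which the factor 1/2 in the trace distance cancels. The bound depends on the inversion error
  alone, so it is uniform in the ciphertext.\<close>

lemma mat_adjoint_dim [simp]:
  "dim_row (mat_adjoint A) = dim_col A" "dim_col (mat_adjoint A) = dim_row A"
  by (simp_all add: mat_adjoint_def)

lemma mat_adjoint_carrier [simp]:
  "A \<in> carrier_mat n m \<Longrightarrow> mat_adjoint A \<in> carrier_mat m n"
  by (auto intro: carrier_matI)

lemma mat_adjoint_index [simp]:
  fixes A :: "complex mat"
  assumes "i < dim_col A" "j < dim_row A"
  shows "mat_adjoint A $$ (i, j) = cnj (A $$ (j, i))"
  using assms by (simp add: mat_adjoint_def mat_of_rows_index)

lemma mat_adjoint_adjoint [simp]: "mat_adjoint (mat_adjoint A) = (A :: complex mat)"
  by (intro eq_matI) auto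

lemma mult_index_sum:
  assumes "i < dim_row A" "j < dim_col B" "dim_col A = dim_row B"
  shows "(A * B) $$ (i, j) = (\<Sum>k < dim_row B. A $$ (i, k) * B $$ (k, j))"
  using assms by (simp add: scalar_prod_def atLeast0LessThan)

lemmas mult_carrier_square = mult_carrier_mat[of _ n n _ n for n]
lemmas assoc_mult_square = assoc_mult_mat[of _ n n _ n _ n for n]

lemma mat_adjoint_mult:
  fixes A :: "complex mat"
  assumes "A \<in> carrier_mat n m" "B \<in> carrier_mat m l"
  shows "mat_adjoint (A * B) = mat_adjoint B * mat_adjoint A"
  using assms
  by (intro eq_matI) (auto simp: mult_index_sum simp del: index_mult_mat(1) intro!: sum.cong)

lemma mat_adjoint_minus:
  fixes A :: "complex mat"
  assumes "A \<in> carrier_mat n m" "B \<in> carrier_mat n m"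
  shows "mat_adjoint (A - B) = mat_adjoint A - mat_adjoint B"
  using assms by (intro eq_matI) auto

lemma mat_adjoint_one [simp]: "mat_adjoint (1\<^sub>m n :: complex mat) = 1\<^sub>m n"
  by (intro eq_matI) auto

section \<open>Unitary matrices\<close>

definition unitary_mat :: "nat \<Rightarrow> complex mat \<Rightarrow> bool" where
  "unitary_mat n U \<longleftrightarrow> U \<in> carrier_mat n n \<and> mat_adjoint U * U = 1\<^sub>m n"

text \<open>For square matrices a left inverse is also a right inverse, which yields the third
  property.\<close>

lemma unitary_matD:
  assumes "unitary_mat n U"
  shows "U \<in> carrier_mat n n" "mat_adjoint U * U = 1\<^sub>m n" "U * mat_adjoint U = 1\<^sub>m n"
  using assms mat_mult_left_right_inverse[of "mat_adjoint U" n U] by (auto simp: unitary_mat_def)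

lemma unitary_mat_one: "unitary_mat n (1\<^sub>m n)"
  by (simp add: unitary_mat_def)

lemma unitary_mat_adjoint: "unitary_mat n U \<Longrightarrow> unitary_mat n (mat_adjoint U)"
  by (frule unitary_matD(1), drule unitary_matD(3)) (simp add: unitary_mat_def)

lemma unitary_mat_mult:
  assumes "unitary_mat n U" "unitary_mat n V"
  shows "unitary_mat n (U * V)"
proof -
  note U = unitary_matD[OF assms(1)] and V = unitary_matD[OF assms(2)]
  have "mat_adjoint (U * V) * (U * V) = mat_adjoint V * ((mat_adjoint U * U) * V)"
    using U(1) V(1)
    by (simp add: mat_adjoint_mult[OF U(1) V(1)] assoc_mult_square[of _ n] mult_carrier_square[of _ n])
  then show ?thesis
    using U V by (simp add: unitary_mat_def)
qed

lemma mat_adjoint_cancel: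
  assumes "unitary_mat n U" "A \<in> carrier_mat n m"
  shows "mat_adjoint U * (U * A) = A" "U * (mat_adjoint U * A) = A"
proof -
  note U = unitary_matD[OF assms(1)]
  have "mat_adjoint U * (U * A) = (mat_adjoint U * U) * A"
    "U * (mat_adjoint U * A) = (U * mat_adjoint U) * A"
    using U(1) assms(2) by (simp_all add: assoc_mult_mat[of _ n n _ n _ m])
  then show "mat_adjoint U * (U * A) = A" "U * (mat_adjoint U * A) = A"
    using U assms(2) by simp_all
qed

text \<open>Complete \<open>v\<close> to a basis, orthogonalize it with \<open>v\<close> kept in
  first place, and normalize every vector; these are the columns of \<open>U\<close>, and
  \<open>c\<close> is the inverse length of \<open>v\<close>.\<close>

lemma unitary_mat_extension:
  fixes v :: "complex vec"
  assumes v: "v \<in> carrier_vec n" and v0: "v \<noteq> 0\<^sub>v n"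
  obtains U c where "unitary_mat n U" "c \<noteq> 0" "\<And>i. i < n \<Longrightarrow> U $$ (i, 0) = c * v $ i"
proof -
  interpret cof_vec_space n "TYPE(complex)" .
  define b where "b = basis_completion v"
  define ws where "ws = gram_schmidt n b"
  note bc = basis_completion[OF v v0, folded b_def]
  have ws: "corthogonal ws" "set ws \<subseteq> carrier_vec n" "length ws = n"
    using gram_schmidt_result[OF bc(2) bc(4) bc(5) refl, folded ws_def] bc(6) by auto
  have n: "n > 0" using v v0 by (intro Nat.gr0I) auto
  obtain b' where "b = v # b'" using bc(6,7) n by (cases b) auto
  then have "hd ws = v" using gram_schmidt_hd[OF v] by (simp add: ws_def)
  with ws(3) n have ws0: "ws ! 0 = v" by (cases ws) auto
  have orth: "(\<Sum>r<n. ws ! i $ r * cnj (ws ! j $ r)) = 0 \<longleftrightarrow> i \<noteq> j" if "i < n" "j < n" for i j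
  proof -
    have "ws ! i \<bullet>c ws ! j = (\<Sum>r<n. ws ! i $ r * cnj (ws ! j $ r))"
      using that ws(2,3) carrier_vecD[of "ws ! j" n] carrier_vecD[of "ws ! i" n]
      by (auto simp: scalar_prod_def atLeast0LessThan subset_iff intro!: sum.cong)
    then show ?thesis
      using ws(1) that unfolding corthogonal_def ws(3) by metis
  qed
  define q where "q j = (\<Sum>r<n. (cmod (ws ! j $ r))\<^sup>2)" for j
  have q: "(\<Sum>r<n. ws ! j $ r * cnj (ws ! j $ r)) = of_real (q j)" for j
    by (simp add: q_def complex_mult_cnj cmod_power2)
  have q0: "q j > 0" if "j < n" for j
  proof -
    have "q j \<ge> 0" unfolding q_def by (intro sum_nonneg) auto
    moreover have "q j \<noteq> 0" using orth[OF that that] q[of j] by auto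
    ultimately show ?thesis by simp
  qed
  define U where "U = mat n n (\<lambda>(r, j). ws ! j $ r / of_real (sqrt (q j)))"
  have "unitary_mat n U"
    unfolding unitary_mat_def
  proof (intro conjI eq_matI)
    fix i j assume "i < dim_row (1\<^sub>m n)" "j < dim_col (1\<^sub>m n)"
    then have ij: "i < n" "j < n" by auto
    have "(mat_adjoint U * U) $$ (i, j) =
        (\<Sum>r<n. ws ! j $ r * cnj (ws ! i $ r)) / (of_real (sqrt (q i)) * of_real (sqrt (q j)))"
      using ij by (subst mult_index_sum)
        (auto simp: U_def sum_divide_distrib mult.commute intro!: sum.cong)
    also have "\<dots> = 1\<^sub>m n $$ (i, j)"
    proof (cases "i = j")
      case True
      have "complex_of_real (sqrt (q i)) * of_real (sqrt (q i)) = of_real (q i)"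
        using q0[OF ij(1)] by (simp flip: of_real_mult)
      with True ij q0[OF ij(1)] show ?thesis by (simp only: q) simp
    qed (use ij orth[of j i] in auto)
    finally show "(mat_adjoint U * U) $$ (i, j) = 1\<^sub>m n $$ (i, j)" .
  qed (auto simp: U_def)
  moreover have "1 / complex_of_real (sqrt (q 0)) \<noteq> 0" using q0[OF n] by simp
  moreover have "U $$ (i, 0) = 1 / complex_of_real (sqrt (q 0)) * v $ i" if "i < n" for i
    using that n ws0 by (simp add: U_def)
  ultimately show thesis using that by blast
qed

definition diag_real :: "nat \<Rightarrow> (nat \<Rightarrow> real) \<Rightarrow> complex mat" where
  "diag_real n d = mat n n (\<lambda>(i, j). if i = j then complex_of_real (d i) else 0)"

lemma diag_real_carrier [simp]: "diag_real n d \<in> carrier_mat n n"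
  by (simp add: diag_real_def)

text \<open>Deflation by induction on the dimension: with an eigenvector as first column of a
  unitary, the conjugated matrix has first column (e, 0, ..., 0). Hermiticity clears the first row
  as well, and the remaining block is Hermitian and one size smaller.\<close>

theorem hermitian_diagonalization:
  assumes "A \<in> carrier_mat n n" "mat_adjoint A = A"
  obtains U d where "unitary_mat n U" "mat_adjoint U * A * U = diag_real n d"
proof -
  have "\<exists>U d. unitary_mat n U \<and> mat_adjoint U * A * U = diag_real n d"
    using assms
  proof (induction n arbitrary: A)
    case 0
    then show ?case
      by (intro exI[of _ "1\<^sub>m 0"] exI[of _ "\<lambda>_. 0"]) (auto simp: unitary_mat_one diag_real_def)
  next
    case (Suc n)
    note A = Suc.prems(1)
    obtain as where as: "char_poly A = (\<Prod>a\<leftarrow>as. [:- a, 1:])" "length as = Suc n"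
      using char_poly_factorized[OF A] by blast
    then obtain e where "poly (char_poly A) e = 0"
      by (cases as) auto
    then have "eigenvalue A e" using eigenvalue_root_char_poly[OF A] by simp
    then obtain v where v: "v \<in> carrier_vec (Suc n)" "v \<noteq> 0\<^sub>v (Suc n)" "A *\<^sub>v v = e \<cdot>\<^sub>v v"
      using A unfolding eigenvalue_def eigenvector_def by auto
    obtain U c where U: "unitary_mat (Suc n) U" and c: "c \<noteq> 0"
      and U0: "\<And>i. i < Suc n \<Longrightarrow> U $$ (i, 0) = c * v $ i"
      using unitary_mat_extension[OF v(1,2)] by blast
    note Uc = unitary_matD[OF U]
    define B where "B = mat_adjoint U * A * U"
    have B: "B \<in> carrier_mat (Suc n) (Suc n)" using A Uc(1) by (simp add: B_def mult_carrier_square[of _ "Suc n"])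
    have Bh: "mat_adjoint B = B"
      using A Uc(1) Suc.prems(2)
      by (simp add: B_def mat_adjoint_mult[of _ "Suc n" "Suc n" _ "Suc n"]
          assoc_mult_square[of _ "Suc n"] mult_carrier_square[of _ "Suc n"])
    have AU0: "(A * U) $$ (i, 0) = e * U $$ (i, 0)" if "i < Suc n" for i
    proof -
      have "(A * U) $$ (i, 0) = (\<Sum>k<Suc n. A $$ (i, k) * (c * v $ k))"
        using that A Uc(1) U0 by (subst mult_index_sum) auto
      also have "\<dots> = c * (A *\<^sub>v v) $ i"
        using that A v(1)
        by (auto simp: scalar_prod_def atLeast0LessThan sum_distrib_left mult_ac simp del: sum.lessThan_Suc
            intro!: sum.cong)
      also have "\<dots> = e * U $$ (i, 0)" using that v(1) U0 by (simp add: v(3))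
      finally show ?thesis .
    qed
    \<comment> \<open>Column 0 of \<open>U\<close> is an eigenvector and \<open>U\<close> is
      unitary, so \<open>B\<close> maps the first unit vector to \<open>e\<close> times
      itself.\<close>
    have B0: "B $$ (i, 0) = (if i = 0 then e else 0)" if "i < Suc n" for i
    proof -
      have "B = mat_adjoint U * (A * U)"
        using A Uc(1) by (simp add: B_def assoc_mult_square[of _ "Suc n"] mult_carrier_square[of _ "Suc n"])
      then have "B $$ (i, 0) = (\<Sum>k<Suc n. mat_adjoint U $$ (i, k) * (e * U $$ (k, 0)))"
        using that A Uc(1) AU0 by (simp add: mult_index_sum del: index_mult_mat(1) sum.lessThan_Suc)
      also have "\<dots> = e * (mat_adjoint U * U) $$ (i, 0)"
        using that Uc(1)
        by (subst mult_index_sum)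
          (auto simp: sum_distrib_left mult_ac simp del: sum.lessThan_Suc intro!: sum.cong)
      finally show ?thesis using that by (simp add: Uc(2))
    qed
    have adjB: "B $$ (i, j) = cnj (B $$ (j, i))" if "i < Suc n" "j < Suc n" for i j
      using mat_adjoint_index[of i B j] that B Bh by simp
    \<comment> \<open>A diagonal entry of a Hermitian matrix is its own conjugate; this is where the
      eigenvalue is seen to be real.\<close>
    have e: "e = of_real (Re e)"
      using adjB[of 0 0] B0[of 0] by (simp add: complex_eq_iff)
    define B3 where "B3 = mat n n (\<lambda>(i, j). B $$ (Suc i, Suc j))"
    have B3: "B3 \<in> carrier_mat n n" by (simp add: B3_def)
    have "mat_adjoint B3 = B3"
      by (intro eq_matI) (auto simp: B3_def adjB[symmetric])
    from Suc.IH[OF B3 this] obtain U3 d3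
      where U3: "unitary_mat n U3" and d3: "mat_adjoint U3 * B3 * U3 = diag_real n d3" by blast
    note U3c = unitary_matD[OF U3]
    \<comment> \<open>\<open>Z\<close> extends a matrix on the smaller block by 1 on the first
      coordinate; it respects products and adjoints.\<close>
    define Z where "Z X = four_block_mat (1\<^sub>m 1) (0\<^sub>m 1 n) (0\<^sub>m n 1) X" for X :: "complex mat"
    have Bblock: "B = four_block_mat (mat 1 1 (\<lambda>_. e)) (0\<^sub>m 1 n) (0\<^sub>m n 1) B3"
    proof (intro eq_matI)
      fix i j assume "i < dim_row (four_block_mat (mat 1 1 (\<lambda>_. e)) (0\<^sub>m 1 n) (0\<^sub>m n 1) B3)"
        "j < dim_col (four_block_mat (mat 1 1 (\<lambda>_. e)) (0\<^sub>m 1 n) (0\<^sub>m n 1) B3)"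
      then have ij: "i < Suc n" "j < Suc n" by (auto simp: B3_def)
      then show "B $$ (i, j) = four_block_mat (mat 1 1 (\<lambda>_. e)) (0\<^sub>m 1 n) (0\<^sub>m n 1) B3 $$ (i, j)"
        using B0[of i] B0[of j] adjB[of i j] by (auto simp: B3_def)
    qed (use B in \<open>auto simp: B3_def\<close>)
    have adjZ: "mat_adjoint (Z U3) = Z (mat_adjoint U3)"
      using U3c(1) by (intro eq_matI) (auto simp: Z_def)
    have ZZ: "Z X * Z Y = Z (X * Y)" if "X \<in> carrier_mat n n" "Y \<in> carrier_mat n n" for X Y
      using that unfolding Z_def
      by (subst mult_four_block_mat[of _ 1 1 _ n _ n _ _ 1 _ n]) auto
    have "unitary_mat (Suc n) (Z U3)"
      unfolding unitary_mat_def adjZ ZZ[OF mat_adjoint_carrier[OF U3c(1)] U3c(1)] U3c(2)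
      using U3c(1) by (auto simp: Z_def intro!: eq_matI)
    then have "unitary_mat (Suc n) (U * Z U3)" (is ?u) using U unitary_mat_mult by blast
    \<comment> \<open>\<open>case_nat\<close> prepends the split-off eigenvalue to those of the
      smaller block.\<close>
    moreover have "mat_adjoint (U * Z U3) * A * (U * Z U3) = diag_real (Suc n) (case_nat (Re e) d3)" (is ?d)
    proof -
      have Zc: "Z U3 \<in> carrier_mat (Suc n) (Suc n)" using U3c(1) by (auto simp: Z_def)
      have "mat_adjoint (U * Z U3) * A * (U * Z U3) = Z (mat_adjoint U3) * B * Z U3"
        using A Uc(1) Zc U3c(1)
        by (simp add: B_def adjZ[symmetric] mat_adjoint_mult[OF Uc(1) Zc]
            assoc_mult_square[of _ "Suc n"] mult_carrier_square[of _ "Suc n"])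
      also have "Z (mat_adjoint U3) * B = four_block_mat (mat 1 1 (\<lambda>_. e)) (0\<^sub>m 1 n) (0\<^sub>m n 1) (mat_adjoint U3 * B3)"
        using U3c(1) B3 unfolding Bblock Z_def
        by (subst mult_four_block_mat[of _ 1 1 _ n _ n _ _ 1 _ n]) auto
      also have "\<dots> * Z U3 = four_block_mat (mat 1 1 (\<lambda>_. e)) (0\<^sub>m 1 n) (0\<^sub>m n 1) (mat_adjoint U3 * B3 * U3)"
        using U3c(1) B3 unfolding Z_def
        by (subst mult_four_block_mat[of _ 1 1 _ n _ n _ _ 1 _ n]) auto
      also have "\<dots> = diag_real (Suc n) (case_nat (Re e) d3)"
        unfolding d3 using e by (intro eq_matI) (auto simp: diag_real_def split: nat.split)
      finally show ?thesis .
    qed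
    ultimately show ?case by blast
  qed
  then show thesis using that by blast
qed

section \<open>Frobenius and trace norms\<close>

text \<open>Matches the wire order of \<open>tensor\<close> and \<open>reduced\<close>:
  \<open>i\<close> is the value of the low wires and \<open>j\<close> that of the high ones.\<close>

lemma sum_lessThan_mult: "(\<Sum>r<a * b. f r) = (\<Sum>j<b. \<Sum>i<a. f (i + a * j :: nat))"
proof -
  have "(\<Sum>r<a * b. f r) = (\<Sum>j<b. sum f {j * a..<j * a + a})"
    by (simp only: sum.nat_group mult.commute[of a b])
  also have "\<dots> = (\<Sum>j<b. \<Sum>i<a. f (i + a * j))"
    using sum.shift_bounds_nat_ivl[of f 0 "_ * a" a]
    by (simp add: atLeast0LessThan add.commute mult.commute)
  finally show ?thesis .
qed

lemma add_mult_less: "i < a \<Longrightarrow> l < L \<Longrightarrow> i + a * l < a * (L :: nat)"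
  using mult_le_mono2[of "Suc l" L a] by simp

text \<open>Stated through \<open>L2_set\<close> over index pairs, so that its triangle and
  Cauchy-Schwarz inequalities apply directly.\<close>

definition frob :: "complex mat \<Rightarrow> real" where
  "frob A = L2_set (\<lambda>(i, j). cmod (A $$ (i, j))) ({..<dim_row A} \<times> {..<dim_col A})"

lemma frob_nonneg [simp]: "frob A \<ge> 0"
  by (simp add: frob_def)

lemma frob_square: "(frob A)\<^sup>2 = (\<Sum>i<dim_row A. \<Sum>j<dim_col A. (cmod (A $$ (i, j)))\<^sup>2)"
  by (simp add: frob_def L2_set_def sum_nonneg sum.cartesian_product case_prod_unfold)

lemma frob_eqI: "(frob A)\<^sup>2 = (frob B)\<^sup>2 \<Longrightarrow> frob A = frob B"
  by (simp add: power2_eq_iff_nonneg)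

text \<open>Links normalizations: a state has trace 1 exactly when its factor has Frobenius norm
  1.\<close>

lemma mtrace_mult_adjoint: "mtrace (A * mat_adjoint A) = of_real ((frob A)\<^sup>2)"
  unfolding frob_square mtrace_def of_real_sum
  by (auto simp: mult_index_sum complex_norm_square simp del: index_mult_mat(1) of_real_power intro!: sum.cong)

lemma mtrace_adjoint_mult: "mtrace (mat_adjoint A * A) = of_real ((frob A)\<^sup>2)"
  unfolding frob_square mtrace_def of_real_sum
  by (subst sum.swap)
    (auto simp: mult_index_sum complex_norm_square mult.commute
      simp del: index_mult_mat(1) of_real_power intro!: sum.cong)

text \<open>Multiplying by \<open>U\<close> from the left leaves the Gram matrix
  \<open>mat_adjoint A * A\<close> unchanged, and its trace is the squared norm.\<close>

lemma frob_unitary: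
  assumes "unitary_mat n U" "A \<in> carrier_mat n m"
  shows "frob (U * A) = frob A"
proof -
  note U = unitary_matD[OF assms(1)]
  have "mat_adjoint (U * A) * (U * A) = mat_adjoint A * (mat_adjoint U * (U * A))"
    using U(1) assms(2)
    by (simp add: mat_adjoint_mult[OF U(1) assms(2)]
        assoc_mult_mat[of "mat_adjoint A" m n "mat_adjoint U" n "U * A" m])
  also have "\<dots> = mat_adjoint A * A"
    using mat_adjoint_cancel(1)[OF assms] by simp
  finally have "complex_of_real ((frob (U * A))\<^sup>2) = of_real ((frob A)\<^sup>2)"
    by (simp only: mtrace_adjoint_mult[symmetric])
  then show ?thesis by (intro frob_eqI) (simp only: of_real_eq_iff)
qed

lemma frob_diff_le:
  assumes "A \<in> carrier_mat n m" "B \<in> carrier_mat n m"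
  shows "frob (A - B) \<le> frob A + frob B"
proof -
  let ?I = "{..<n} \<times> {..<m}"
  have "frob (A - B) \<le> L2_set (\<lambda>x. cmod (A $$ x) + cmod (B $$ x)) ?I"
    using assms by (auto simp: frob_def intro!: L2_set_mono norm_triangle_ineq4)
  also have "\<dots> \<le> frob A + frob B"
    using assms L2_set_triangle_ineq[of "\<lambda>x. cmod (A $$ x)" "\<lambda>x. cmod (B $$ x)" ?I]
    by (simp add: frob_def case_prod_unfold)
  finally show ?thesis .
qed

text \<open>\<open>mat_adjoint D * D\<close> is similar to the diagonal matrix of the
  \<open>(d i)\<^sup>2\<close>, so these are the roots of its characteristic polynomial with
  multiplicity, and their square roots are the absolute eigenvalues.\<close>

lemma trace_norm_diag:
  assumes D: "D \<in> carrier_mat n n" and U: "unitary_mat n U"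
    and d: "mat_adjoint U * D * U = diag_real n d"
  shows "trace_norm D = (\<Sum>i<n. \<bar>d i\<bar>)"
proof -
  note Uc = unitary_matD[OF U]
  let ?\<Delta> = "diag_real n d" and ?S = "diag_real n (\<lambda>i. (d i)\<^sup>2)"
  note sq = assoc_mult_square[of _ n] mult_carrier_square[of _ n]
  have adj: "mat_adjoint ?\<Delta> = ?\<Delta>"
    by (intro eq_matI) (auto simp: diag_real_def)
  have "?\<Delta> * ?\<Delta> = ?S"
    by (intro eq_matI)
      (auto simp: diag_real_def mult_index_sum power2_eq_square sum.delta
        if_distrib[of "\<lambda>x. x * _"] cong: if_cong simp del: index_mult_mat(1))
  moreover have "mat_adjoint (mat_adjoint U * D * U) = mat_adjoint U * mat_adjoint D * U"
    using D Uc(1) by (simp add: mat_adjoint_mult[of _ n n _ n] sq)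
  ultimately have "?S = mat_adjoint U * mat_adjoint D * U * (mat_adjoint U * D * U)"
    using adj d by simp
  also have "\<dots> = mat_adjoint U * (mat_adjoint D * D) * U"
    using D Uc(1) mat_adjoint_cancel(2)[OF U, of "D * U" n]
    by (simp add: sq)
  finally have "similar_mat_wit ?S (mat_adjoint D * D) (mat_adjoint U) U"
    using D Uc by (intro similar_mat_witI[of _ _ n]) (auto simp: mult_carrier_square[of _ n])
  then have "char_poly (mat_adjoint D * D) = char_poly ?S"
    using char_poly_similar[of ?S "mat_adjoint D * D"] unfolding similar_mat_def by metis
  also have "\<dots> = (\<Prod>a\<leftarrow>diag_mat ?S. [:- a, 1:])"
    by (rule char_poly_upper_triangular[of _ n])
      (auto simp: diag_real_def upper_triangular_def)
  finally have cp: "char_poly (mat_adjoint D * D) = (\<Prod>a\<leftarrow>diag_mat ?S. [:- a, 1:])" .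
  have "proots (\<Prod>a\<leftarrow>as. [:- a, 1:]) = mset as" for as :: "complex list"
  proof (induction as)
    case (Cons a as)
    have "(\<Prod>a\<leftarrow>as. [:- a, 1:]) \<noteq> 0"
      by (auto simp: prod_list_zero_iff)
    then show ?case using Cons by (simp add: proots_mult del: mult_pCons_left)
  qed simp
  then have "trace_norm D = (\<Sum>e\<in>#mset (diag_mat ?S). sqrt (Re e))"
    by (simp add: trace_norm_def cp)
  also have "diag_mat ?S = map (\<lambda>i. complex_of_real ((d i)\<^sup>2)) [0..<n]"
    by (auto simp: diag_mat_def diag_real_def)
  also have "(\<Sum>e\<in>#mset \<dots>. sqrt (Re e)) = (\<Sum>i<n. \<bar>d i\<bar>)"
    by (simp add: atLeast0LessThan[symmetric] sum_mset_sum_list interv_sum_list_conv_sum_set_nat comp_def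
        flip: mset_map)
  finally show ?thesis .
qed

lemma sum_mult_le_frob:
  assumes "A \<in> carrier_mat n m" "B \<in> carrier_mat n m"
  shows "(\<Sum>i<n. \<Sum>c<m. cmod (A $$ (i, c)) * cmod (B $$ (i, c))) \<le> frob A * frob B"
  using assms L2_set_mult_ineq[of "\<lambda>x. cmod (A $$ x)" "\<lambda>x. cmod (B $$ x)" "{..<n} \<times> {..<m}"]
  by (simp add: frob_def case_prod_unfold sum.cartesian_product)

text \<open>Each eigenvalue of \<open>D\<close> is a diagonal entry in the eigenbasis, hence a sum
  of two inner products of rows of the rotated factors; summing absolute values over the rows leaves
  one Cauchy-Schwarz estimate per product. Treating two products at once replaces a triangle
  inequality for the trace norm.\<close>

lemma trace_norm_le:
  assumes D: "D \<in> carrier_mat n n" "mat_adjoint D = D" "D = A * mat_adjoint B + C * mat_adjoint E"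
    and A: "A \<in> carrier_mat n m" and B: "B \<in> carrier_mat n m"
    and C: "C \<in> carrier_mat n m" and E: "E \<in> carrier_mat n m"
  shows "trace_norm D \<le> frob A * frob B + frob C * frob E"
proof -
  obtain U d where U: "unitary_mat n U" and d: "mat_adjoint U * D * U = diag_real n d"
    using hermitian_diagonalization[OF D(1,2)] by blast
  note Uc = unitary_matD[OF U]
  define W where "W = mat_adjoint U"
  have W: "unitary_mat n W" and Wc: "W \<in> carrier_mat n n" and UW: "U = mat_adjoint W"
    using unitary_mat_adjoint[OF U] Uc(1) by (simp_all add: W_def)
  have "W * D * U = (W * A) * mat_adjoint (W * B) + (W * C) * mat_adjoint (W * E)"
  proof -
    have "W * (X * mat_adjoint Y) * U = (W * X) * mat_adjoint (W * Y)"
      if X: "X \<in> carrier_mat n m" and Y: "Y \<in> carrier_mat n m" for X Y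
    proof -
      have "(W * X) * mat_adjoint (W * Y) = W * X * (mat_adjoint Y * U)"
        using UW by (simp add: mat_adjoint_mult[OF Wc Y])
      also have "\<dots> = W * (X * (mat_adjoint Y * U))"
        using X Y Wc Uc(1) by (intro assoc_mult_mat[of _ n n _ m _ n]) auto
      also have "X * (mat_adjoint Y * U) = X * mat_adjoint Y * U"
        using X Y Uc(1) by (intro assoc_mult_mat[of _ n m _ n _ n, symmetric]) auto
      also have "W * (X * mat_adjoint Y * U) = W * (X * mat_adjoint Y) * U"
        using X Y Wc Uc(1) by (intro assoc_mult_mat[of _ n n _ n _ n, symmetric]) auto
      finally show ?thesis by simp
    qed
    moreover have "W * D * U = W * (A * mat_adjoint B) * U + W * (C * mat_adjoint E) * U"
    proof -
      have AB: "A * mat_adjoint B \<in> carrier_mat n n" and CE: "C * mat_adjoint E \<in> carrier_mat n n"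
        using A B C E by auto
      then have "W * D = W * (A * mat_adjoint B) + W * (C * mat_adjoint E)"
        using Wc unfolding D(3) by (intro mult_add_distrib_mat) auto
      then show ?thesis
        using add_mult_distrib_mat[OF _ _ Uc(1), of "W * (A * mat_adjoint B)" n "W * (C * mat_adjoint E)"]
          AB CE Wc by (simp add: mult_carrier_square[of _ n])
    qed
    ultimately show ?thesis using A B C E by simp
  qed
  then have dd: "diag_real n d = (W * A) * mat_adjoint (W * B) + (W * C) * mat_adjoint (W * E)"
    using d by (simp add: W_def)
  define A' B' C' E' where "A' = W * A" "B' = W * B" "C' = W * C" "E' = W * E"
  note defs = A'_B'_C'_E'_def
  have car: "A' \<in> carrier_mat n m" "B' \<in> carrier_mat n m" "C' \<in> carrier_mat n m" "E' \<in> carrier_mat n m"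
    using A B C E Wc by (auto simp: defs)
  have "\<bar>d i\<bar> \<le> (\<Sum>c<m. cmod (A' $$ (i, c)) * cmod (B' $$ (i, c)))
      + (\<Sum>c<m. cmod (C' $$ (i, c)) * cmod (E' $$ (i, c)))" if i: "i < n" for i
  proof -
    have "complex_of_real (d i) = (A' * mat_adjoint B' + C' * mat_adjoint E') $$ (i, i)"
      using i dd[folded defs] by (simp add: diag_real_def flip: dd[folded defs])
    also have "\<dots> = (\<Sum>c<m. A' $$ (i, c) * cnj (B' $$ (i, c))) + (\<Sum>c<m. C' $$ (i, c) * cnj (E' $$ (i, c)))"
      using i car by (simp add: mult_index_sum del: index_mult_mat(1))
    finally have "\<bar>d i\<bar> = cmod \<dots>" by (metis norm_of_real)
    also have "\<dots> \<le> cmod (\<Sum>c<m. A' $$ (i, c) * cnj (B' $$ (i, c)))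
        + cmod (\<Sum>c<m. C' $$ (i, c) * cnj (E' $$ (i, c)))" by (rule norm_triangle_ineq)
    also have "\<dots> \<le> (\<Sum>c<m. cmod (A' $$ (i, c)) * cmod (B' $$ (i, c)))
        + (\<Sum>c<m. cmod (C' $$ (i, c)) * cmod (E' $$ (i, c)))"
      by (intro add_mono sum_norm_le) (auto simp: norm_mult)
    finally show ?thesis .
  qed
  then have "(\<Sum>i<n. \<bar>d i\<bar>) \<le> (\<Sum>i<n. (\<Sum>c<m. cmod (A' $$ (i, c)) * cmod (B' $$ (i, c)))
      + (\<Sum>c<m. cmod (C' $$ (i, c)) * cmod (E' $$ (i, c))))"
    by (intro sum_mono) auto
  also have "\<dots> \<le> frob A' * frob B' + frob C' * frob E'"
    unfolding sum.distrib by (intro add_mono sum_mult_le_frob car)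
  also have "\<dots> = frob A * frob B + frob C * frob E"
    unfolding defs using frob_unitary[OF W] A B C E by simp
  finally show ?thesis using trace_norm_diag[OF D(1) U d] by simp
qed

text \<open>
  A factor of the state obtained by tracing out the wires from \<open>t\<close> upwards and adjoining a classical
  string: the traced-out wires become part of the column index.
\<close>

definition key_factor :: "bool list \<Rightarrow> nat \<Rightarrow> nat \<Rightarrow> complex mat \<Rightarrow> complex mat" where
  "key_factor s T L Z = mat (2 ^ length s * T) (dim_col Z * L)
     (\<lambda>(r, q). if r mod 2 ^ length s = horner_sum of_bool 2 s
       then Z $$ (r div 2 ^ length s + T * (q div dim_col Z), q mod dim_col Z) else 0)"

lemma horner_sum_less: "horner_sum of_bool 2 s < (2 :: nat) ^ length s"
  by (induction s) (auto simp: horner_sum_simps)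

text \<open>A rearrangement: every entry of \<open>Z\<close> occurs exactly once, in a row whose low
  wires spell \<open>s\<close>, and all other entries are 0.\<close>

lemma frob_key_factor:
  assumes "Z \<in> carrier_mat (T * L) m"
  shows "frob (key_factor s T L Z) = frob Z"
proof (rule frob_eqI)
  let ?E = "2 ^ length s" and ?p = "horner_sum of_bool 2 s :: nat"
  have p: "?p < ?E" by (rule horner_sum_less)
  have "(frob (key_factor s T L Z))\<^sup>2
      = (\<Sum>i<T. \<Sum>r<?E. \<Sum>l<L. \<Sum>c<m. if r = ?p then (cmod (Z $$ (i + T * l, c)))\<^sup>2 else 0)"
    using assms unfolding frob_square key_factor_def
    by (auto simp: sum_lessThan_mult if_distrib div_add1_eq div_mult_self1 add.commute less_mult_imp_div_less intro!: sum.cong)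
  also have "\<dots> = (\<Sum>i<T. \<Sum>r<?E. if r = ?p then \<Sum>l<L. \<Sum>c<m. (cmod (Z $$ (i + T * l, c)))\<^sup>2 else 0)"
    by (intro sum.cong refl) auto
  also have "\<dots> = (frob Z)\<^sup>2"
    using assms p by (simp add: frob_square sum_lessThan_mult sum.swap[of _ "{..<T}" "{..<L}"])
  finally show "(frob (key_factor s T L Z))\<^sup>2 = (frob Z)\<^sup>2" .
qed

text \<open>The sum over the enlarged column index runs over \<open>l\<close> and \<open>c\<close>:
  \<open>c\<close> gives the matrix product and \<open>l\<close> the partial trace. The rows
  selected by \<open>s\<close> supply the basis state.\<close>

lemma key_factor_mult:
  assumes A: "A \<in> carrier_mat (2 ^ t * L) m" and B: "B \<in> carrier_mat (2 ^ t * L) m"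
  shows "key_factor s (2 ^ t) L A * mat_adjoint (key_factor s (2 ^ t) L B)
    = tensor (basis_state s) (reduced t (A * mat_adjoint B))"
proof (intro eq_matI)
  let ?E = "2 ^ length s" and ?p = "horner_sum of_bool 2 s :: nat"
  fix r r' assume "r < dim_row (tensor (basis_state s) (reduced t (A * mat_adjoint B)))"
    "r' < dim_col (tensor (basis_state s) (reduced t (A * mat_adjoint B)))"
  then have r: "r < ?E * 2 ^ t" "r' < ?E * 2 ^ t"
    by (auto simp: tensor_def basis_state_def reduced_def)
  then have rd: "r div ?E < 2 ^ t" "r' div ?E < 2 ^ t"
    by (auto simp: less_mult_imp_div_less mult.commute)
  have less: "i + 2 ^ t * l < 2 ^ t * L" if "i < 2 ^ t" "l < L" for i l
    using that by (rule add_mult_less)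
  have "(key_factor s (2 ^ t) L A * mat_adjoint (key_factor s (2 ^ t) L B)) $$ (r, r')
      = (\<Sum>l<L. \<Sum>c<m. of_bool (r mod ?E = ?p \<and> r' mod ?E = ?p) *
          (A $$ (r div ?E + 2 ^ t * l, c) * cnj (B $$ (r' div ?E + 2 ^ t * l, c))))"
    using r A B
    by (auto simp: mult_index_sum key_factor_def sum_lessThan_mult simp del: index_mult_mat(1)
        intro!: sum.cong)
  also have "\<dots> = of_bool (r mod ?E = ?p \<and> r' mod ?E = ?p) *
      (\<Sum>l<L. \<Sum>c<m. A $$ (r div ?E + 2 ^ t * l, c) * cnj (B $$ (r' div ?E + 2 ^ t * l, c)))"
    by (simp only: sum_distrib_left)
  also have "\<dots> = tensor (basis_state s) (reduced t (A * mat_adjoint B)) $$ (r, r')"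
    using r rd A B less
    by (auto simp: tensor_def basis_state_def reduced_def mult_index_sum simp del: index_mult_mat(1)
        intro!: sum.cong)
  finally show "(key_factor s (2 ^ t) L A * mat_adjoint (key_factor s (2 ^ t) L B)) $$ (r, r')
    = tensor (basis_state s) (reduced t (A * mat_adjoint B)) $$ (r, r')" .
qed (auto simp: key_factor_def tensor_def basis_state_def reduced_def)

lemma key_factor_diff:
  assumes "A \<in> carrier_mat (T * L) m" "B \<in> carrier_mat (T * L) m"
  shows "key_factor s T L (A - B) = key_factor s T L A - key_factor s T L B"
proof (intro eq_matI)
  fix r q assume "r < dim_row (key_factor s T L A - key_factor s T L B)"
    "q < dim_col (key_factor s T L A - key_factor s T L B)"
  then have rq: "r < 2 ^ length s * T" "q < m * L" using assms by (auto simp: key_factor_def)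
  then have "m > 0" by (cases m) auto
  then have "q mod m < m" by simp
  from rq have "r div 2 ^ length s < T" "q div m < L"
    by (auto simp: less_mult_imp_div_less mult.commute)
  then have "r div 2 ^ length s + T * (q div m) < T * L" by (rule add_mult_less)
  with \<open>q mod m < m\<close> show "key_factor s T L (A - B) $$ (r, q) = (key_factor s T L A - key_factor s T L B) $$ (r, q)"
    using rq assms by (simp add: key_factor_def)
qed (use assms in \<open>auto simp: key_factor_def\<close>)

text \<open>Both gram matrices are compared through \<open>X X* - Y Y* = (X - Y) X* + Y (X - Y)*\<close>.\<close>

lemma trace_distance_key_le:
  assumes X: "X \<in> carrier_mat (2 ^ t * L) m" and Y: "Y \<in> carrier_mat (2 ^ t * L) m"
    and "frob X \<le> 1" "frob Y \<le> 1"
  shows "trace_distance (tensor (basis_state s) (reduced t (X * mat_adjoint X)))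
      (tensor (basis_state s) (reduced t (Y * mat_adjoint Y))) \<le> frob (X - Y)"
proof -
  let ?K = "key_factor s (2 ^ t) L"
  define P Q where "P = ?K X" "Q = ?K Y"
  note PQ = P_Q_def
  have P: "P \<in> carrier_mat (2 ^ length s * 2 ^ t) (m * L)"
    and Q: "Q \<in> carrier_mat (2 ^ length s * 2 ^ t) (m * L)"
    using X Y by (auto simp: PQ key_factor_def)
  define D where "D = P * mat_adjoint P - Q * mat_adjoint Q"
  let ?n = "2 ^ length s * 2 ^ t"
  have D: "D \<in> carrier_mat ?n ?n" using P Q by (auto simp: D_def)
  have herm: "mat_adjoint D = D"
    using P Q
    by (simp add: D_def mat_adjoint_minus[of _ ?n ?n] mat_adjoint_mult[OF P mat_adjoint_carrier[OF P]]
        mat_adjoint_mult[OF Q mat_adjoint_carrier[OF Q]])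
  have "D = (P - Q) * mat_adjoint P + Q * mat_adjoint (P - Q)"
  proof (intro eq_matI)
    fix i j assume "i < dim_row ((P - Q) * mat_adjoint P + Q * mat_adjoint (P - Q))"
      "j < dim_col ((P - Q) * mat_adjoint P + Q * mat_adjoint (P - Q))"
    then have "i < ?n" "j < ?n" using P Q by auto
    then show "D $$ (i, j) = ((P - Q) * mat_adjoint P + Q * mat_adjoint (P - Q)) $$ (i, j)"
      using P Q
      by (simp add: D_def mult_index_sum algebra_simps flip: sum.distrib sum_subtractf
          del: index_mult_mat(1))
  qed (use P Q D in auto)
  then have "trace_norm D \<le> frob (P - Q) * frob P + frob Q * frob (P - Q)"
    using P Q by (intro trace_norm_le[OF D herm]) auto
  also have "frob (P - Q) = frob (X - Y)"
    using X Y by (simp add: PQ key_factor_diff[symmetric] frob_key_factor[OF minus_carrier_mat[OF Y]])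
  also have "frob P = frob X" using X by (simp add: PQ frob_key_factor[of _ _ _ m])
  also have "frob Q = frob Y" using Y by (simp add: PQ frob_key_factor[of _ _ _ m])
  \<comment> \<open>Each of the two terms costs one \<open>frob (X - Y)\<close> since the norms are
    at most 1; the factor 1/2 in the trace distance absorbs the doubling.\<close>
  also have "frob (X - Y) * frob X + frob Y * frob (X - Y) \<le> frob (X - Y) * 1 + 1 * frob (X - Y)"
    using assms(3,4) by (intro add_mono mult_mono) auto
  finally have "trace_norm D / 2 \<le> frob (X - Y)" by simp
  then show ?thesis
    using key_factor_mult[OF X X, of s] key_factor_mult[OF Y Y, of s]
    by (simp add: trace_distance_def D_def PQ)
qed

section \<open>Measurements and states\<close>

lemma frob_eq_0: "frob A = 0 \<longleftrightarrow> (\<forall>i<dim_row A. \<forall>j<dim_col A. A $$ (i, j) = 0)"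
  by (auto simp: frob_def L2_set_eq_0_iff)

lemma frob_smult: "frob (c \<cdot>\<^sub>m A) = cmod c * frob A"
proof -
  have "(frob (c \<cdot>\<^sub>m A))\<^sup>2 = (cmod c * frob A)\<^sup>2"
    by (simp add: power_mult_distrib frob_square norm_mult sum_distrib_left)
  then show ?thesis by (simp add: power2_eq_iff_nonneg)
qed

lemma gram_smult_real:
  "(complex_of_real r \<cdot>\<^sub>m A) * mat_adjoint (complex_of_real r \<cdot>\<^sub>m A)
    = complex_of_real (r\<^sup>2) \<cdot>\<^sub>m (A * mat_adjoint A)"
  by (intro eq_matI)
    (auto simp: mult_index_sum sum_distrib_left power2_eq_square mult_ac simp del: index_mult_mat(1))

text \<open>Every density operator has this form: positivity gives a factor \<open>L\<close>, and
  the unit norm of \<open>L\<close> is the trace condition. The number \<open>m\<close> of columns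
  is left free, so mixed states are included and no particular square root has to be chosen.\<close>

definition is_state :: "nat \<Rightarrow> complex mat \<Rightarrow> bool" where
  "is_state d \<rho> \<longleftrightarrow> (\<exists>m L. L \<in> carrier_mat d m \<and> frob L = 1 \<and> \<rho> = L * mat_adjoint L)"

section \<open>Projections onto measurement outcomes and the Born rule\<close>

lemma outcome_proj_dim [simp]:
  "dim_row (outcome_proj d qs s) = d" "dim_col (outcome_proj d qs s) = d"
  by (simp_all add: outcome_proj_def)

lemma outcome_proj_carrier [simp]: "outcome_proj d qs s \<in> carrier_mat d d"
  by (simp add: outcome_proj_def)

lemma adjoint_outcome_proj [simp]: "mat_adjoint (outcome_proj d qs s) = outcome_proj d qs s"
  by (intro eq_matI) (auto simp: outcome_proj_def)

lemma outcome_proj_mult: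
  assumes "A \<in> carrier_mat d m"
  shows "outcome_proj d qs s * A = mat d m (\<lambda>(i, c). of_bool (map (bit i) qs = s) * A $$ (i, c))"
proof (intro eq_matI)
  fix i c assume "i < dim_row (mat d m (\<lambda>(i, c). of_bool (map (bit i) qs = s) * A $$ (i, c)))"
    "c < dim_col (mat d m (\<lambda>(i, c). of_bool (map (bit i) qs = s) * A $$ (i, c)))"
  then have "i < d" "c < m" by auto
  then show "(outcome_proj d qs s * A) $$ (i, c)
      = mat d m (\<lambda>(i, c). of_bool (map (bit i) qs = s) * A $$ (i, c)) $$ (i, c)"
    using assms
    by (simp add: mult_index_sum outcome_proj_def of_bool_conj mult.assoc del: index_mult_mat(1))
qed (use assms in auto)

text \<open>Pythagoras: the projection keeps some rows and zeroes the others, so every entry goes to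
  exactly one of the two parts.\<close>

lemma frob_outcome_proj_split:
  assumes "A \<in> carrier_mat d m"
  shows "(frob A)\<^sup>2 = (frob (outcome_proj d qs s * A))\<^sup>2 + (frob (A - outcome_proj d qs s * A))\<^sup>2"
proof -
  have "(cmod x)\<^sup>2 = (cmod (of_bool b * x))\<^sup>2 + (cmod (x - of_bool b * x))\<^sup>2" for b x
    by (cases b) auto
  then show ?thesis
    using assms unfolding frob_square sum.distrib[symmetric]
    by (simp add: outcome_proj_mult sum.distrib[symmetric])
qed

text \<open>Each row belongs to exactly one outcome. The sum ranges over the attained outcomes only,
  which keeps it finite.\<close>

lemma sum_frob_outcome_proj:
  assumes "A \<in> carrier_mat d m"
  shows "(\<Sum>s\<in>(\<lambda>i. map (bit i) qs) ` {..<d}. (frob (outcome_proj d qs s * A))\<^sup>2) = (frob A)\<^sup>2"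
proof -
  have "(frob A)\<^sup>2 = (\<Sum>s\<in>(\<lambda>i. map (bit i) qs) ` {..<d}.
      \<Sum>i\<in>{i\<in>{..<d}. map (bit i) qs = s}. \<Sum>c<m. (cmod (A $$ (i, c)))\<^sup>2)"
    using assms by (subst sum.group) (auto simp: frob_square)
  also have "\<dots> = (\<Sum>s\<in>(\<lambda>i. map (bit i) qs) ` {..<d}. (frob (outcome_proj d qs s * A))\<^sup>2)"
  proof (intro sum.cong refl)
    fix s
    have "(frob (outcome_proj d qs s * A))\<^sup>2 = (\<Sum>i<d. if map (bit i) qs = s then \<Sum>c<m. (cmod (A $$ (i, c)))\<^sup>2 else 0)"
      using assms by (auto simp: frob_square outcome_proj_mult intro!: sum.cong)
    then show "(\<Sum>i\<in>{i\<in>{..<d}. map (bit i) qs = s}. \<Sum>c<m. (cmod (A $$ (i, c)))\<^sup>2)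
        = (frob (outcome_proj d qs s * A))\<^sup>2"
      by (simp only: sum.inter_filter finite_lessThan)
  qed
  finally show ?thesis by simp
qed

lemma outcome_proj_mult_eq_0:
  assumes "A \<in> carrier_mat d m" "s \<notin> (\<lambda>i. map (bit i) qs) ` {..<d}"
  shows "frob (outcome_proj d qs s * A) = 0"
  using assms by (auto simp: frob_eq_0 outcome_proj_mult)

text \<open>With the state factored, the Born weight of \<open>s\<close> is the squared norm of the
  projected factor. The weights sum to 1, so \<open>embed_pmf\<close> yields a distribution with
  exactly this mass function.\<close>

lemma measure_wires_gram:
  assumes L: "L \<in> carrier_mat d m" and 1: "frob L = 1"
  obtains M :: "bool list pmf"
  where "\<And>s. pmf M s = (frob (outcome_proj d qs s * L))\<^sup>2"
    "measure_wires qs (L * mat_adjoint L) = map_pmf (\<lambda>s. (s,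
        complex_of_real (1 / (frob (outcome_proj d qs s * L))\<^sup>2) \<cdot>\<^sub>m
          ((outcome_proj d qs s * L) * mat_adjoint (outcome_proj d qs s * L)))) M"
proof -
  let ?P = "outcome_proj d qs" and ?S = "(\<lambda>i. map (bit i) qs) ` {..<d}"
  let ?q = "\<lambda>s. (frob (?P s * L))\<^sup>2"
  have gram: "?P s * (L * mat_adjoint L) * ?P s = (?P s * L) * mat_adjoint (?P s * L)" for s
  proof -
    have "(?P s * L) * mat_adjoint (?P s * L) = (?P s * L) * (mat_adjoint L * ?P s)"
      by (simp add: mat_adjoint_mult[OF outcome_proj_carrier L])
    also have "\<dots> = ?P s * L * mat_adjoint L * ?P s"
      using L by (intro assoc_mult_mat[of _ d m _ d _ d, symmetric]) auto
    also have "?P s * L * mat_adjoint L = ?P s * (L * mat_adjoint L)"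
      using L by (intro assoc_mult_mat[of _ d d _ m _ d]) auto
    finally show ?thesis ..
  qed
  have "(\<integral>\<^sup>+s. ennreal (?q s) \<partial>count_space UNIV) = (\<Sum>s\<in>?S. ennreal (?q s))"
    using outcome_proj_mult_eq_0[OF L] by (intro nn_integral_count_space') auto
  also have "\<dots> = 1"
    by (simp add: sum_ennreal sum_frob_outcome_proj[OF L] 1)
  finally have pmf: "pmf (embed_pmf ?q) s = ?q s" for s
    by (intro pmf_embed_pmf) auto
  have "measure_wires qs (L * mat_adjoint L) = map_pmf (\<lambda>s. (s,
        complex_of_real (1 / ?q s) \<cdot>\<^sub>m ((?P s * L) * mat_adjoint (?P s * L)))) (embed_pmf ?q)"
    using L by (simp add: measure_wires_def Let_def gram mtrace_mult_adjoint del: of_real_power)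
  then show thesis using pmf that by blast
qed

text \<open>A factor of the post-measurement state is the projected factor divided by its norm,
  which is nonzero for every outcome in the support.\<close>

lemma is_state_measure_wires:
  assumes "is_state d \<rho>" "(s, \<rho>') \<in> set_pmf (measure_wires qs \<rho>)"
  shows "is_state d \<rho>'"
proof -
  obtain m L where L: "L \<in> carrier_mat d m" "frob L = 1" and \<rho>: "\<rho> = L * mat_adjoint L"
    using assms(1) by (auto simp: is_state_def)
  let ?A = "outcome_proj d qs s * L"
  obtain M where M: "\<And>s. pmf M s = (frob (outcome_proj d qs s * L))\<^sup>2"
    and mw: "measure_wires qs \<rho> = map_pmf (\<lambda>s. (s,
        complex_of_real (1 / (frob (outcome_proj d qs s * L))\<^sup>2) \<cdot>\<^sub>m
          ((outcome_proj d qs s * L) * mat_adjoint (outcome_proj d qs s * L)))) M"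
    using measure_wires_gram[OF L] unfolding \<rho> by blast
  have "pmf M s \<noteq> 0" and \<rho>': "\<rho>' = complex_of_real (1 / (frob ?A)\<^sup>2) \<cdot>\<^sub>m (?A * mat_adjoint ?A)"
    using assms(2) unfolding mw by (auto simp: set_pmf_iff)
  then have 0: "frob ?A \<noteq> 0" by (simp add: M)
  let ?B = "complex_of_real (1 / frob ?A) \<cdot>\<^sub>m ?A"
  have "?B \<in> carrier_mat d m" using L(1) by auto
  moreover have "frob ?B = 1" using 0 by (simp add: frob_smult norm_divide)
  moreover have "\<rho>' = ?B * mat_adjoint ?B"
    unfolding \<rho>' gram_smult_real by (simp add: power_one_over)
  ultimately show ?thesis unfolding is_state_def by blast
qed

lemma prob_measure_wires:
  assumes "L \<in> carrier_mat d m" "frob L = 1"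
  shows "measure_pmf.prob (measure_wires qs (L * mat_adjoint L)) {(s', \<rho>). s' = s}
    = (frob (outcome_proj d qs s * L))\<^sup>2"
proof -
  obtain M where "\<And>s. pmf M s = (frob (outcome_proj d qs s * L))\<^sup>2"
    and mw: "measure_wires qs (L * mat_adjoint L) = map_pmf (\<lambda>s. (s,
        complex_of_real (1 / (frob (outcome_proj d qs s * L))\<^sup>2) \<cdot>\<^sub>m
          ((outcome_proj d qs s * L) * mat_adjoint (outcome_proj d qs s * L)))) M"
    using measure_wires_gram[OF assms] by blast
  moreover have "measure_pmf.prob (map_pmf (\<lambda>s. (s, g s)) M) {(s', \<rho>). s' = s} = pmf M s" for g :: "bool list \<Rightarrow> complex mat"
    by (simp add: vimage_def measure_pmf_single)
  ultimately show ?thesis by simp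
qed

section \<open>Measurements of wires that are traced out\<close>

lemma bit_add_mult_power:
  assumes "i < 2 ^ t" "t \<le> q"
  shows "bit (i + 2 ^ t * l :: nat) q = bit l (q - t)"
proof -
  have "(i + 2 ^ t * l) div 2 ^ q = (i + 2 ^ t * l) div 2 ^ t div 2 ^ (q - t)"
    using assms(2) by (simp only: flip: div_mult2_eq power_add) simp
  also have "(i + 2 ^ t * l) div 2 ^ t = l" using assms(1) by simp
  finally show ?thesis by (simp add: bit_iff_odd)
qed

text \<open>No signalling from discarded wires: the two indices of a summand of the partial trace
  agree on all wires from \<open>t\<close> upwards, hence on the measured ones, so the summand
  survives under exactly one outcome, and the normalization cancels against the probability.\<close>

lemma expectation_reduced_measure_wires:
  assumes L: "L \<in> carrier_mat (2 ^ N) m" "frob L = 1" and "t \<le> N" and qs: "\<forall>q\<in>set qs. t \<le> q"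
    and ij: "i < 2 ^ t" "j < 2 ^ t"
  shows "measure_pmf.expectation (measure_wires qs (L * mat_adjoint L)) (\<lambda>(s, \<rho>). reduced t \<rho> $$ (i, j))
    = reduced t (L * mat_adjoint L) $$ (i, j)"
proof -
  let ?P = "outcome_proj (2 ^ N) qs" and ?S = "(\<lambda>i. map (bit i) qs) ` {..<2 ^ N :: nat}"
  obtain M where M: "\<And>s. pmf M s = (frob (?P s * L))\<^sup>2"
    and mw: "measure_wires qs (L * mat_adjoint L) = map_pmf (\<lambda>s. (s,
        complex_of_real (1 / (frob (?P s * L))\<^sup>2) \<cdot>\<^sub>m ((?P s * L) * mat_adjoint (?P s * L)))) M"
    using measure_wires_gram[OF L] by blast
  have N: "(2 :: nat) ^ N = 2 ^ t * 2 ^ (N - t)" using \<open>t \<le> N\<close> by (simp flip: power_add)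
  have less: "k + 2 ^ t * l < 2 ^ N" if "k < 2 ^ t" "l < 2 ^ (N - t)" for k l :: nat
    unfolding N using that by (rule add_mult_less)
  have div: "(2 :: nat) ^ N div 2 ^ t = 2 ^ (N - t)" by (simp add: N)
  have same: "map (bit (i + 2 ^ t * l)) qs = map (bit (j + 2 ^ t * l)) qs" for l
    using qs ij by (simp add: bit_add_mult_power)
  define G where "G = L * mat_adjoint L"
  have PG: "((?P s * L) * mat_adjoint (?P s * L)) $$ (i + 2 ^ t * l, j + 2 ^ t * l)
      = (if map (bit (i + 2 ^ t * l)) qs = s then G $$ (i + 2 ^ t * l, j + 2 ^ t * l) else 0)"
    if "l < 2 ^ (N - t)" for l s
    using less[OF ij(1) that] less[OF ij(2) that] L(1)
    by (simp add: outcome_proj_mult[OF L(1)] mult_index_sum G_def same del: index_mult_mat(1))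
  have "measure_pmf.expectation (measure_wires qs (L * mat_adjoint L)) (\<lambda>(s, \<rho>). reduced t \<rho> $$ (i, j))
      = (\<Sum>s\<in>?S. (frob (?P s * L))\<^sup>2 *\<^sub>R reduced t (complex_of_real (1 / (frob (?P s * L))\<^sup>2) \<cdot>\<^sub>m
          ((?P s * L) * mat_adjoint (?P s * L))) $$ (i, j))"
    unfolding mw M[symmetric] using outcome_proj_mult_eq_0[OF L(1), of _ qs]
    by (simp, intro integral_measure_pmf) (auto simp: set_pmf_iff M)
  also have "\<dots> = (\<Sum>s\<in>?S. \<Sum>l<2 ^ (N - t).
      if map (bit (i + 2 ^ t * l)) qs = s then G $$ (i + 2 ^ t * l, j + 2 ^ t * l) else 0)"
  proof (intro sum.cong refl)
    fix s
    let ?A = "?P s * L" and ?q = "(frob (?P s * L))\<^sup>2"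
    have A: "?A \<in> carrier_mat (2 ^ N) m" using L(1) by auto
    have "?q *\<^sub>R reduced t (complex_of_real (1 / ?q) \<cdot>\<^sub>m (?A * mat_adjoint ?A)) $$ (i, j)
        = (\<Sum>l<2 ^ (N - t). complex_of_real ?q * (complex_of_real (1 / ?q) *
            (?A * mat_adjoint ?A) $$ (i + 2 ^ t * l, j + 2 ^ t * l)))"
      using ij A less
      by (simp add: reduced_def div scaleR_conv_of_real sum_distrib_left del: index_mult_mat(1))
    also have "\<dots> = (\<Sum>l<2 ^ (N - t). (?A * mat_adjoint ?A) $$ (i + 2 ^ t * l, j + 2 ^ t * l))"
    \<comment> \<open>For an outcome of probability 0 the normalizing factor is 1/0 = 0; the
      projected factor vanishes there too, so both sides are 0.\<close>
    proof (cases "frob ?A = 0")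
      case True
      then have "(?A * mat_adjoint ?A) $$ (i + 2 ^ t * l, j + 2 ^ t * l) = 0" if "l < 2 ^ (N - t)" for l
        using A ij less that by (simp add: frob_eq_0 mult_index_sum del: index_mult_mat(1))
      then show ?thesis using True by simp
    qed simp
    also have "\<dots> = (\<Sum>l<2 ^ (N - t).
        if map (bit (i + 2 ^ t * l)) qs = s then G $$ (i + 2 ^ t * l, j + 2 ^ t * l) else 0)"
      by (intro sum.cong refl PG) auto
    finally show "?q *\<^sub>R reduced t (complex_of_real (1 / ?q) \<cdot>\<^sub>m (?A * mat_adjoint ?A)) $$ (i, j) = \<dots>" .
  qed
  also have "\<dots> = (\<Sum>l<2 ^ (N - t). G $$ (i + 2 ^ t * l, j + 2 ^ t * l))"
  proof -
    have "map (bit (i + 2 ^ t * l)) qs \<in> ?S" if "l < 2 ^ (N - t)" for l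
      using less[OF ij(1) that] by (intro imageI) simp
    then show ?thesis by (subst sum.swap) (simp add: sum.delta)
  qed
  also have "\<dots> = reduced t (L * mat_adjoint L) $$ (i, j)"
    using ij L(1) by (simp add: reduced_def div G_def del: index_mult_mat(1))
  finally show ?thesis .
qed

section \<open>Partial traces and ancillas in terms of factors\<close>

lemma tensor_basis_state_Nil [simp]: "tensor (basis_state []) A = A"
  by (intro eq_matI) (auto simp: tensor_def basis_state_def)

text \<open>\<open>key_factor\<close> with the empty string only moves the traced-out wires into the
  column index, which gives a factor of the reduced state with the same norm.\<close>

lemma is_state_reduced:
  assumes "is_state (2 ^ N) \<rho>" "t \<le> N"
  shows "is_state (2 ^ t) (reduced t \<rho>)"
proof -
  obtain m L where L: "L \<in> carrier_mat (2 ^ N) m" "frob L = 1" and \<rho>: "\<rho> = L * mat_adjoint L"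
    using assms(1) by (auto simp: is_state_def)
  have L': "L \<in> carrier_mat (2 ^ t * 2 ^ (N - t)) m"
    using L(1) \<open>t \<le> N\<close> by (simp flip: power_add)
  let ?K = "key_factor [] (2 ^ t) (2 ^ (N - t)) L"
  have "?K \<in> carrier_mat (2 ^ t) (m * 2 ^ (N - t))" using L(1) by (simp add: key_factor_def)
  then show ?thesis
    using key_factor_mult[OF L' L', of "[]"] frob_key_factor[OF L', of "[]"] L(2) \<rho>
    unfolding is_state_def by (intro exI[of _ "m * 2 ^ (N - t)"] exI[of _ ?K]) auto
qed

text \<open>The effect on a factor of adjoining ancillas in state 0: ancillas are the most
  significant bits, so the old entries fill the first rows and all others are 0.\<close>

definition pad :: "nat \<Rightarrow> complex mat \<Rightarrow> complex mat" where
  "pad N A = mat (2 ^ N) (dim_col A) (\<lambda>(i, c). if i < dim_row A then A $$ (i, c) else 0)"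

lemma pad_carrier [simp]: "A \<in> carrier_mat d m \<Longrightarrow> pad N A \<in> carrier_mat (2 ^ N) m"
  by (simp add: pad_def)

lemma frob_pad:
  assumes "dim_row A \<le> 2 ^ N"
  shows "frob (pad N A) = frob A"
proof (rule frob_eqI)
  have "(frob (pad N A))\<^sup>2 = (\<Sum>i<2 ^ N. if i \<in> {..<dim_row A} then \<Sum>c<dim_col A. (cmod (A $$ (i, c)))\<^sup>2 else 0)"
    by (auto simp: frob_square pad_def intro!: sum.cong)
  also have "\<dots> = (frob A)\<^sup>2"
    using assms by (simp only: sum.inter_restrict[symmetric] finite_lessThan frob_square)
      (simp add: Int_absorb1)
  finally show "(frob (pad N A))\<^sup>2 = (frob A)\<^sup>2" .
qed

lemma tensor_zero_state:
  assumes L: "L \<in> carrier_mat (2 ^ k) m" and "k \<le> N"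
  shows "tensor (L * mat_adjoint L) (zero_state (N - k)) = pad N L * mat_adjoint (pad N L)"
proof (intro eq_matI)
  have N: "(2 :: nat) ^ N = 2 ^ k * 2 ^ (N - k)" using \<open>k \<le> N\<close> by (simp flip: power_add)
  have 0: "horner_sum of_bool 2 (replicate n False) = (0 :: nat)" for n
    by (induction n) auto
  fix i j assume "i < dim_row (pad N L * mat_adjoint (pad N L))" "j < dim_col (pad N L * mat_adjoint (pad N L))"
  then have ij: "i < 2 ^ N" "j < 2 ^ N" by (auto simp: pad_def)
  have small: "i div 2 ^ k = 0 \<longleftrightarrow> i < 2 ^ k" for i :: nat by (simp add: div_eq_0_iff)
  show "tensor (L * mat_adjoint L) (zero_state (N - k)) $$ (i, j) = (pad N L * mat_adjoint (pad N L)) $$ (i, j)"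
    using ij L
    by (auto simp: tensor_def zero_state_def basis_state_def 0 pad_def mult_index_sum small
        less_mult_imp_div_less N mult.commute simp del: index_mult_mat(1))
qed (use assms in \<open>auto simp: tensor_def zero_state_def basis_state_def pad_def simp flip: power_add\<close>)

text \<open>Only the block in which all discarded wires are 0 contributes to the partial
  trace.\<close>

lemma reduced_pad:
  assumes L: "L \<in> carrier_mat (2 ^ k) m" and "k \<le> N"
  shows "reduced k (pad N L * mat_adjoint (pad N L)) = L * mat_adjoint L"
proof (intro eq_matI)
  have N: "(2 :: nat) ^ N = 2 ^ k * 2 ^ (N - k)" using \<open>k \<le> N\<close> by (simp flip: power_add)
  then have div: "(2 :: nat) ^ N div 2 ^ k = 2 ^ (N - k)" by simp
  fix i j assume "i < dim_row (L * mat_adjoint L)" "j < dim_col (L * mat_adjoint L)"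
  then have ij: "i < 2 ^ k" "j < 2 ^ k" using L by auto
  have less: "i' + 2 ^ k * l < 2 ^ N" if "i' < 2 ^ k" "l < 2 ^ (N - k)" for i' l :: nat
    unfolding N using that by (rule add_mult_less)
  have zero: "i' + 2 ^ k * l < 2 ^ k \<longleftrightarrow> l = 0" if "i' < 2 ^ k" for i' l :: nat
    using that by (cases l) auto
  have "reduced k (pad N L * mat_adjoint (pad N L)) $$ (i, j)
      = (\<Sum>l<2 ^ (N - k). \<Sum>c<m. (if l = 0 then L $$ (i + 2 ^ k * l, c) else 0) *
          cnj (if l = 0 then L $$ (j + 2 ^ k * l, c) else 0))"
    using ij L less zero by (simp add: reduced_def pad_def div mult_index_sum del: index_mult_mat(1))
  also have "\<dots> = (\<Sum>l<2 ^ (N - k). if l = (0 :: nat) then \<Sum>c<m. L $$ (i, c) * cnj (L $$ (j, c)) else 0)"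
    by (intro sum.cong refl) auto
  also have "\<dots> = (L * mat_adjoint L) $$ (i, j)"
    using ij L by (simp add: mult_index_sum del: index_mult_mat(1))
  finally show "reduced k (pad N L * mat_adjoint (pad N L)) $$ (i, j) = (L * mat_adjoint L) $$ (i, j)" .
qed (use L in \<open>auto simp: reduced_def\<close>)

lemma evolve_gram:
  assumes "U \<in> carrier_mat n n" "L \<in> carrier_mat n m"
  shows "evolve U (L * mat_adjoint L) = (U * L) * mat_adjoint (U * L)"
proof -
  have "(U * L) * mat_adjoint (U * L) = U * L * (mat_adjoint L * mat_adjoint U)"
    by (simp add: mat_adjoint_mult[OF assms])
  also have "\<dots> = U * L * mat_adjoint L * mat_adjoint U"
    using assms by (intro assoc_mult_mat[of _ n m _ n _ n, symmetric]) auto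
  also have "U * L * mat_adjoint L = U * (L * mat_adjoint L)"
    using assms by (intro assoc_mult_mat[of _ n n _ m _ n]) auto
  finally show ?thesis by (simp add: evolve_def)
qed

section \<open>Circuits\<close>

unbundle bit_operations_syntax

section \<open>Bit arithmetic on basis indices\<close>

lemma less_power2_iff_bits: "(i :: nat) < 2 ^ N \<longleftrightarrow> (\<forall>q\<ge>N. \<not> bit i q)"
  by (simp add: take_bit_nat_eq_self_iff[symmetric] bit_eq_iff bit_take_bit_iff) (metis not_le)

lemma flip_bit_less: "q < N \<Longrightarrow> flip_bit q i < 2 ^ N \<longleftrightarrow> (i :: nat) < 2 ^ N"
  by (auto simp: less_power2_iff_bits bit_simps)

lemma xor_less: "m < 2 ^ N \<Longrightarrow> i XOR m < 2 ^ N \<longleftrightarrow> (i :: nat) < 2 ^ N"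
  by (auto simp: less_power2_iff_bits bit_simps)

lemma flip_bit_flip_bit [simp]: "flip_bit q (flip_bit q i) = (i :: nat)"
  by (auto simp: bit_eq_iff bit_simps)

lemma flip_bit_neq [simp]: "flip_bit q i \<noteq> (i :: nat)" "i \<noteq> flip_bit q (i :: nat)"
  by (auto simp: bit_eq_iff bit_simps)

lemma flip_bit_eq_iff [simp]: "flip_bit q i = flip_bit q j \<longleftrightarrow> i = (j :: nat)"
  by (metis flip_bit_flip_bit)

text \<open>Describes the sparsity of a Hadamard gate: column \<open>j\<close> is nonzero only in
  the rows \<open>j\<close> and \<open>flip_bit q j\<close>.\<close>

lemma unset_bit_eq_iff: "unset_bit q i = unset_bit q j \<longleftrightarrow> i = j \<or> i = flip_bit q (j :: nat)"
proof
  assume eq: "unset_bit q i = unset_bit q j"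
  have other: "bit i n = bit j n" if "n \<noteq> q" for n
    using arg_cong[OF eq, of "\<lambda>x. bit x n"] that by (simp add: bit_unset_bit_iff)
  show "i = j \<or> i = flip_bit q j"
  proof (cases "bit i q = bit j q")
    case True
    then have "i = j" by (intro bit_eqI) (metis other)
    then show ?thesis ..
  next
    case False
    then have "i = flip_bit q j"
      by (intro bit_eqI) (metis other bit_flip_bit_iff possible_bit_nat)
    then show ?thesis ..
  qed
qed (auto simp: bit_eq_iff bit_simps)

section \<open>Unitarity of gates and circuits\<close>

lemma gate_mat_carrier [simp]: "gate_mat N g \<in> carrier_mat (2 ^ N) (2 ^ N)"
  by (cases g) (auto simp: perm_mat_def)

lemma gate_mat_dim [simp]: "dim_row (gate_mat N g) = 2 ^ N" "dim_col (gate_mat N g) = 2 ^ N"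
  using gate_mat_carrier[of N g] by (auto simp del: gate_mat_carrier)

lemma perm_mat_carrier [simp]: "perm_mat N \<pi> \<in> carrier_mat (2 ^ N) (2 ^ N)"
  by (simp add: perm_mat_def)

lemma unitary_perm_mat:
  assumes "\<And>i. i < 2 ^ N \<Longrightarrow> \<pi> i < 2 ^ N" "inj_on \<pi> {..<2 ^ N}"
  shows "unitary_mat (2 ^ N) (perm_mat N \<pi>)"
  unfolding unitary_mat_def
proof (intro conjI eq_matI)
  fix i j assume "i < dim_row (1\<^sub>m (2 ^ N))" "j < dim_col (1\<^sub>m (2 ^ N))"
  then have ij: "i < 2 ^ N" "j < 2 ^ N" by auto
  have "(mat_adjoint (perm_mat N \<pi>) * perm_mat N \<pi>) $$ (i, j)
      = (\<Sum>k<2 ^ N. if k = \<pi> i then of_bool (\<pi> i = \<pi> j) else 0)"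
    using ij by (auto simp: mult_index_sum perm_mat_def simp del: index_mult_mat(1) intro!: sum.cong)
  also have "\<dots> = 1\<^sub>m (2 ^ N) $$ (i, j)"
    using ij assms(1)[of i] inj_on_eq_iff[OF assms(2), of i j] by simp
  finally show "(mat_adjoint (perm_mat N \<pi>) * perm_mat N \<pi>) $$ (i, j) = 1\<^sub>m (2 ^ N) $$ (i, j)" .
qed (auto simp: perm_mat_def)

lemma unitary_gate_mat:
  assumes "gate_ok N g"
  shows "unitary_mat (2 ^ N) (gate_mat N g)"
proof (cases g)
  case (Hadamard q)
  have q: "q < N" using assms Hadamard by simp
  define H where "H = gate_mat N g"
  have H: "H $$ (i, j) = (if i = j \<or> i = flip_bit q j then (if bit i q \<and> bit j q then - 1 else 1) / complex_of_real (sqrt 2) else 0)"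
    if "i < 2 ^ N" "j < 2 ^ N" for i j
    using that by (simp add: H_def Hadamard unset_bit_eq_iff)
  have Hc: "H \<in> carrier_mat (2 ^ N) (2 ^ N)" by (simp add: H_def)
  have 2: "complex_of_real (sqrt 2) * complex_of_real (sqrt 2) = 2"
    by (simp flip: of_real_mult)
  have "mat_adjoint H * H = 1\<^sub>m (2 ^ N)"
  proof (intro eq_matI)
    fix i j assume "i < dim_row (1\<^sub>m (2 ^ N))" "j < dim_col (1\<^sub>m (2 ^ N))"
    then have ij: "i < 2 ^ N" "j < 2 ^ N" by auto
    then have fi: "flip_bit q i < 2 ^ N" "flip_bit q j < 2 ^ N" using q by (auto simp: flip_bit_less)
    have "(mat_adjoint H * H) $$ (i, j) = (\<Sum>k<2 ^ N. cnj (H $$ (k, i)) * H $$ (k, j))"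
      using ij Hc by (simp add: mult_index_sum del: index_mult_mat(1))
    \<comment> \<open>Column \<open>i\<close> lives on these two rows. The products add up to 1 if
      \<open>i = j\<close>, cancel if \<open>j\<close> is the flip of \<open>i\<close>, and vanish
      otherwise.\<close>
    also have "\<dots> = (\<Sum>k\<in>{i, flip_bit q i}. cnj (H $$ (k, i)) * H $$ (k, j))"
      using ij fi by (intro sum.mono_neutral_right) (auto simp: H)
    also have "\<dots> = 1\<^sub>m (2 ^ N) $$ (i, j)"
      using ij fi 2 by (auto simp: H bit_simps)
    finally show "(mat_adjoint H * H) $$ (i, j) = 1\<^sub>m (2 ^ N) $$ (i, j)" .
  qed (use Hc in auto)
  with Hc show ?thesis by (simp add: unitary_mat_def H_def)
next
  case (TGate q)
  have "mat_adjoint (gate_mat N g) * gate_mat N g = 1\<^sub>m (2 ^ N)"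
  proof (intro eq_matI)
    fix i j assume "i < dim_row (1\<^sub>m (2 ^ N))" "j < dim_col (1\<^sub>m (2 ^ N))"
    then have ij: "i < 2 ^ N" "j < 2 ^ N" by auto
    have "(mat_adjoint (gate_mat N g) * gate_mat N g) $$ (i, j)
        = (\<Sum>k<2 ^ N. cnj (gate_mat N g $$ (k, i)) * gate_mat N g $$ (k, j))"
      using ij by (simp add: mult_index_sum del: index_mult_mat(1))
    also have "\<dots> = (\<Sum>k<2 ^ N. if k = i then of_bool (i = j) else 0)"
      using ij TGate by (intro sum.cong refl) (auto simp: cis_mult cis_cnj)
    finally show "(mat_adjoint (gate_mat N g) * gate_mat N g) $$ (i, j) = 1\<^sub>m (2 ^ N) $$ (i, j)"
      using ij by simp
  qed auto
  then show ?thesis by (simp add: unitary_mat_def)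
next
  case (CNot p q)
  \<comment> \<open>CNot is its own inverse because the control differs from the target and is never
    flipped.\<close>
  have "inj_on (\<lambda>j :: nat. if bit j p then flip_bit q j else j) {..<2 ^ N}"
    using assms CNot
    by (intro inj_on_inverseI[where g = "\<lambda>j :: nat. if bit j p then flip_bit q j else j"])
      (auto simp: bit_simps)
  then show ?thesis
    using assms CNot by (auto intro!: unitary_perm_mat simp: flip_bit_less)
qed

lemma gates_mat_Nil [simp]: "gates_mat N [] = 1\<^sub>m (2 ^ N)"
  by (simp add: gates_mat_def)

lemma gates_mat_snoc [simp]: "gates_mat N (gs @ [g]) = gate_mat N g * gates_mat N gs"
  by (simp add: gates_mat_def)

lemma gates_mat_carrier [simp]: "gates_mat N gs \<in> carrier_mat (2 ^ N) (2 ^ N)"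
  by (induction gs rule: rev_induct) (simp_all add: mult_carrier_square)

lemma unitary_gates_mat:
  "\<forall>g\<in>set gs. gate_ok N g \<Longrightarrow> unitary_mat (2 ^ N) (gates_mat N gs)"
  by (induction gs rule: rev_induct) (auto simp: unitary_mat_one intro: unitary_mat_mult unitary_gate_mat)

section \<open>Circuits run on a wider register\<close>

lemma gate_ok_mono: "gate_ok w g \<Longrightarrow> w \<le> N \<Longrightarrow> gate_ok N g"
  by (cases g) auto

lemma gate_mat_pad:
  assumes g: "gate_ok w g" and "w \<le> N" and A: "A \<in> carrier_mat (2 ^ w) m"
  shows "gate_mat N g * pad N A = pad N (gate_mat w g * A)"
proof (intro eq_matI)
  have wN: "(2 :: nat) ^ w \<le> 2 ^ N" using \<open>w \<le> N\<close> by simp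
  have entry: "gate_mat N g $$ (i, j) = (if i < 2 ^ w then gate_mat w g $$ (i, j) else 0)"
    if ij: "i < 2 ^ N" "j < 2 ^ w" for i j
  proof -
    have j: "j < 2 ^ N" using ij(2) wN by linarith
    show ?thesis
    proof (cases g)
      case (Hadamard q)
      then have "q < w" using g by simp
      then show ?thesis
        using ij Hadamard flip_bit_less[of q w j] by (auto simp: unset_bit_eq_iff j)
    next
      case (TGate q)
      then show ?thesis using ij by (auto simp: j)
    next
      case (CNot p q)
      then have "q < w" using g by simp
      then show ?thesis
        using ij CNot flip_bit_less[of q w j] by (auto simp: perm_mat_def j)
    qed
  qed
  fix i c assume "i < dim_row (pad N (gate_mat w g * A))" "c < dim_col (pad N (gate_mat w g * A))"
  then have ic: "i < 2 ^ N" "c < m" using A by (auto simp: pad_def)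
  have "(gate_mat N g * pad N A) $$ (i, c) = (\<Sum>j<2 ^ N. if j < 2 ^ w then gate_mat N g $$ (i, j) * A $$ (j, c) else 0)"
    using ic A by (auto simp: mult_index_sum pad_def simp del: index_mult_mat(1) intro!: sum.cong)
  also have "\<dots> = (\<Sum>j<2 ^ w. gate_mat N g $$ (i, j) * A $$ (j, c))"
    using wN by (intro sum.mono_neutral_cong_right) auto
  also have "\<dots> = pad N (gate_mat w g * A) $$ (i, c)"
    using ic A by (auto simp: pad_def mult_index_sum entry simp del: index_mult_mat(1))
  finally show "(gate_mat N g * pad N A) $$ (i, c) = pad N (gate_mat w g * A) $$ (i, c)" .
qed (use A in \<open>auto simp: pad_def\<close>)

lemma gates_mat_pad:
  assumes "\<forall>g\<in>set gs. gate_ok w g" "w \<le> N" "A \<in> carrier_mat (2 ^ w) m"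
  shows "gates_mat N gs * pad N A = pad N (gates_mat w gs * A)"
  using assms(1)
proof (induction gs rule: rev_induct)
  case Nil
  then show ?case
    using left_mult_one_mat[OF pad_carrier[OF assms(3)]] assms(3) by simp
next
  case (snoc g gs)
  have "gates_mat N (gs @ [g]) * pad N A = gate_mat N g * (gates_mat N gs * pad N A)"
    using assms(3) by (simp add: assoc_mult_mat[of _ "2 ^ N" "2 ^ N" _ "2 ^ N" _ m])
  also have "\<dots> = gate_mat N g * pad N (gates_mat w gs * A)"
    using snoc by simp
  also have "\<dots> = pad N (gate_mat w g * (gates_mat w gs * A))"
    using snoc assms(2) mult_carrier_mat[OF gates_mat_carrier assms(3)]
    by (intro gate_mat_pad[of _ _ _ _ m]) auto
  also have "gate_mat w g * (gates_mat w gs * A) = gates_mat w (gs @ [g]) * A"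
    using assms(3) by (simp add: assoc_mult_mat[of _ "2 ^ w" "2 ^ w" _ "2 ^ w" _ m])
  finally show ?case .
qed

section \<open>Constant masks on wires\<close>

text \<open>A product of Pauli X gates on the wires whose bits are set in \<open>m\<close>; copying
  a fixed classical result takes this form.\<close>

definition xor_mat :: "nat \<Rightarrow> nat \<Rightarrow> complex mat" where
  "xor_mat N m = perm_mat N (\<lambda>i. i XOR m)"

lemma xor_mat_carrier [simp]: "xor_mat N m \<in> carrier_mat (2 ^ N) (2 ^ N)"
  by (simp add: xor_mat_def)

lemma xor_xor_cancel [simp]: "(i XOR m) XOR m = (i :: nat)"
  by (auto simp: bit_eq_iff bit_simps)

lemma unitary_xor_mat: "m < 2 ^ N \<Longrightarrow> unitary_mat (2 ^ N) (xor_mat N m)"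
  unfolding xor_mat_def
  by (intro unitary_perm_mat) (auto simp: xor_less intro: inj_on_inverseI[where g = "\<lambda>i. i XOR m"])

lemma xor_mat_mult_index:
  assumes "m < 2 ^ N" "A \<in> carrier_mat (2 ^ N) d" "i < 2 ^ N" "c < d"
  shows "(xor_mat N m * A) $$ (i, c) = A $$ (i XOR m, c)"
proof -
  have "i = j XOR m \<longleftrightarrow> j = i XOR m" for j by auto
  then have "(xor_mat N m * A) $$ (i, c) = (\<Sum>j<2 ^ N. if j = i XOR m then A $$ (j, c) else 0)"
    using assms
    by (auto simp: mult_index_sum xor_mat_def perm_mat_def simp del: index_mult_mat(1) intro!: sum.cong)
  then show ?thesis using assms by (simp add: xor_less)
qed

lemma mult_xor_mat_index:
  assumes "m < 2 ^ N" "A \<in> carrier_mat d (2 ^ N)" "i < d" "j < 2 ^ N"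
  shows "(A * xor_mat N m) $$ (i, j) = A $$ (i, j XOR m)"
proof -
  have "(A * xor_mat N m) $$ (i, j) = (\<Sum>k<2 ^ N. if k = j XOR m then A $$ (i, k) else 0)"
    using assms
    by (auto simp: mult_index_sum xor_mat_def perm_mat_def simp del: index_mult_mat(1) intro!: sum.cong)
  then show ?thesis using assms by (simp add: xor_less)
qed

lemma xor_mat_commuteI:
  assumes "m < 2 ^ N" "A \<in> carrier_mat (2 ^ N) (2 ^ N)"
    and "\<And>i j. i < 2 ^ N \<Longrightarrow> j < 2 ^ N \<Longrightarrow> A $$ (i XOR m, j XOR m) = A $$ (i, j)"
  shows "xor_mat N m * A = A * xor_mat N m"
proof (intro eq_matI)
  fix i j assume "i < dim_row (A * xor_mat N m)" "j < dim_col (A * xor_mat N m)"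
  then have ij: "i < 2 ^ N" "j < 2 ^ N" using assms(2) by (auto simp: xor_mat_def perm_mat_def)
  then show "(xor_mat N m * A) $$ (i, j) = (A * xor_mat N m) $$ (i, j)"
    \<comment> \<open>Multiplication from the left masks the row index, from the right the column
      index; invariance at column \<open>j XOR m\<close> converts one into the other.\<close>
    using assms(1,2) assms(3)[of i "j XOR m"]
    by (simp add: xor_mat_mult_index[OF _ _ ij] mult_xor_mat_index[OF _ _ ij] xor_less)
qed (use assms in \<open>auto simp: xor_mat_def perm_mat_def\<close>)

text \<open>The gate reads and changes only wires below \<open>w\<close>, the mask only wires from
  \<open>w\<close> on.\<close>

lemma xor_mat_commute_gate:
  assumes g: "gate_ok w g" and m: "m < 2 ^ N" and mw: "\<And>q. q < w \<Longrightarrow> \<not> bit m q"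
  shows "xor_mat N m * gate_mat N g = gate_mat N g * xor_mat N m"
proof (rule xor_mat_commuteI[OF m])
  have eq: "i XOR m = j XOR m \<longleftrightarrow> i = j" for i j by (metis xor_xor_cancel)
  have flip: "flip_bit q j XOR m = flip_bit q (j XOR m)" for q j
    by (auto simp: bit_eq_iff bit_simps)
  fix i j :: nat assume ij: "i < 2 ^ N" "j < 2 ^ N"
  then have ij': "i XOR m < 2 ^ N" "j XOR m < 2 ^ N" using m by (auto simp: xor_less)
  show "gate_mat N g $$ (i XOR m, j XOR m) = gate_mat N g $$ (i, j)"
  proof (cases g)
    case (Hadamard q)
    then have "\<not> bit m q" using mw g by simp
    then show ?thesis
      using ij ij' Hadamard by (simp add: unset_bit_eq_iff eq flip[symmetric] bit_simps)
  next
    case (TGate q)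
    then have "\<not> bit m q" using mw g by simp
    then show ?thesis using ij ij' TGate by (simp add: eq bit_simps)
  next
    case (CNot p q)
    then have "\<not> bit m p" using mw g by simp
    then show ?thesis using ij ij' CNot by (simp add: perm_mat_def eq flip[symmetric] bit_simps)
  qed
qed simp

lemma commute_mult:
  assumes "X \<in> carrier_mat n n" "A \<in> carrier_mat n n" "B \<in> carrier_mat n n"
    and "X * A = A * X" "X * B = B * X"
  shows "X * (A * B) = (A * B) * X"
proof -
  note sq = assoc_mult_square[of _ n] mult_carrier_square[of _ n]
  have "X * (A * B) = (X * A) * B" using assms(1-3) by (simp add: sq)
  also have "\<dots> = A * (X * B)" unfolding assms(4) using assms(1-3) by (simp add: sq)
  also have "\<dots> = (A * B) * X" unfolding assms(5) using assms(1-3) by (simp add: sq)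
  finally show ?thesis .
qed

lemma xor_mat_commute_gates:
  assumes "\<forall>g\<in>set gs. gate_ok w g" and m: "m < 2 ^ N" and mw: "\<And>q. q < w \<Longrightarrow> \<not> bit m q"
  shows "xor_mat N m * gates_mat N gs = gates_mat N gs * xor_mat N m"
  using assms(1)
proof (induction gs rule: rev_induct)
  case (snoc g gs)
  then show ?case
    using xor_mat_commute_gate[OF _ m mw, of w g] unfolding gates_mat_snoc
    by (intro commute_mult[of _ "2 ^ N"]) auto
qed (simp add: right_mult_one_mat[OF xor_mat_carrier] left_mult_one_mat[OF xor_mat_carrier])

lemma bit_add_mult_power_less:
  assumes "q < t"
  shows "bit (i + 2 ^ t * l :: nat) q = bit i q"
proof -
  have "take_bit t (i + 2 ^ t * l) = take_bit t i" by (simp add: take_bit_eq_mod)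
  then show ?thesis using assms by (metis bit_take_bit_iff)
qed

text \<open>The mask is confined to discarded wires, where it only permutes the summation index of
  the partial trace by \<open>l XOR m'\<close>.\<close>

lemma reduced_xor_mat:
  assumes "t \<le> N" and m: "m < 2 ^ N" and mt: "\<And>q. q < t \<Longrightarrow> \<not> bit m q"
    and A: "A \<in> carrier_mat (2 ^ N) d"
  shows "reduced t ((xor_mat N m * A) * mat_adjoint (xor_mat N m * A)) = reduced t (A * mat_adjoint A)"
proof (intro eq_matI)
  define m' where "m' = m div 2 ^ t"
  have N: "(2 :: nat) ^ N = 2 ^ t * 2 ^ (N - t)" using \<open>t \<le> N\<close> by (simp flip: power_add)
  then have div: "(2 :: nat) ^ N div 2 ^ t = 2 ^ (N - t)" by simp
  have m': "m' < 2 ^ (N - t)"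
    using m unfolding m'_def N by (simp add: less_mult_imp_div_less mult.commute)
  have less: "i + 2 ^ t * l < 2 ^ N" if "i < 2 ^ t" "l < 2 ^ (N - t)" for i l :: nat
    unfolding N using that by (rule add_mult_less)
  have xor: "(i + 2 ^ t * l) XOR m = i + 2 ^ t * (l XOR m')" if "i < 2 ^ t" for i l
  proof (rule bit_eqI)
    fix q
    show "bit ((i + 2 ^ t * l) XOR m) q = bit (i + 2 ^ t * (l XOR m')) q"
    proof (cases "q < t")
      case True
      then show ?thesis by (simp add: bit_xor_iff bit_add_mult_power_less mt)
    next
      case False
      then have "bit m' (q - t) = bit m q"
        by (simp add: m'_def bit_iff_odd flip: div_mult2_eq power_add)
      then show ?thesis using False that by (simp add: bit_xor_iff bit_add_mult_power)
    qed
  qed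
  fix i j assume "i < dim_row (reduced t (A * mat_adjoint A))" "j < dim_col (reduced t (A * mat_adjoint A))"
  then have ij: "i < 2 ^ t" "j < 2 ^ t" by (auto simp: reduced_def)
  define G where "G = A * mat_adjoint A"
  have "reduced t ((xor_mat N m * A) * mat_adjoint (xor_mat N m * A)) $$ (i, j)
      = (\<Sum>l<2 ^ (N - t). G $$ (i + 2 ^ t * (l XOR m'), j + 2 ^ t * (l XOR m')))"
  proof -
    have "((xor_mat N m * A) * mat_adjoint (xor_mat N m * A)) $$ (i + 2 ^ t * l, j + 2 ^ t * l)
        = G $$ (i + 2 ^ t * (l XOR m'), j + 2 ^ t * (l XOR m'))" if l: "l < 2 ^ (N - t)" for l
    proof -
      have l': "l XOR m' < 2 ^ (N - t)" using l m' by (simp add: xor_less)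
      have "dim_row (xor_mat N m * A) = 2 ^ N" "dim_col (xor_mat N m * A) = d"
        using A by (auto simp: xor_mat_def perm_mat_def)
      then show ?thesis
        using ij A less[OF ij(1) l] less[OF ij(2) l] less[OF ij(1) l'] less[OF ij(2) l']
        unfolding G_def
        by (subst (1 2) mult_index_sum) (auto simp: xor_mat_mult_index[OF m A] xor simp del: index_mult_mat)
    qed
    moreover have "dim_row ((xor_mat N m * A) * mat_adjoint (xor_mat N m * A)) = 2 ^ N"
      by (simp add: xor_mat_def perm_mat_def)
    ultimately show ?thesis using ij by (simp add: reduced_def div del: index_mult_mat(1))
  qed
  also have "\<dots> = (\<Sum>l<2 ^ (N - t). G $$ (i + 2 ^ t * l, j + 2 ^ t * l))"
    by (rule sum.reindex_bij_witness[of _ "\<lambda>l. l XOR m'" "\<lambda>l. l XOR m'"])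
      (use m' in \<open>auto simp: xor_less\<close>)
  also have "\<dots> = reduced t (A * mat_adjoint A) $$ (i, j)"
    using ij A by (simp add: reduced_def div G_def del: index_mult_mat(1))
  finally show "reduced t ((xor_mat N m * A) * mat_adjoint (xor_mat N m * A)) $$ (i, j)
    = reduced t (A * mat_adjoint A) $$ (i, j)" .
qed (auto simp: reduced_def)

lemma perm_mat_mult:
  assumes "\<And>i. i < 2 ^ N \<Longrightarrow> \<pi> i < 2 ^ N"
  shows "perm_mat N \<pi>' * perm_mat N \<pi> = perm_mat N (\<lambda>i. \<pi>' (\<pi> i))"
proof (intro eq_matI)
  fix i j assume "i < dim_row (perm_mat N (\<lambda>i. \<pi>' (\<pi> i)))" "j < dim_col (perm_mat N (\<lambda>i. \<pi>' (\<pi> i)))"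
  then have ij: "i < 2 ^ N" "j < 2 ^ N" by (auto simp: perm_mat_def)
  have "(perm_mat N \<pi>' * perm_mat N \<pi>) $$ (i, j) = (\<Sum>k<2 ^ N. if k = \<pi> j then of_bool (i = \<pi>' (\<pi> j)) else 0)"
    using ij by (auto simp: mult_index_sum perm_mat_def simp del: index_mult_mat(1) intro!: sum.cong)
  then show "(perm_mat N \<pi>' * perm_mat N \<pi>) $$ (i, j) = perm_mat N (\<lambda>i. \<pi>' (\<pi> i)) $$ (i, j)"
    using ij assms[of j] by (simp add: perm_mat_def)
qed (auto simp: perm_mat_def)

text \<open>Only the indices of nonzero rows of \<open>A\<close> matter. This lets the copy be
  replaced by a constant mask on the part of the state that has one definite result.\<close>

lemma perm_mat_mult_cong:
  assumes A: "A \<in> carrier_mat (2 ^ N) m"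
    and eq: "\<And>j c. j < 2 ^ N \<Longrightarrow> c < m \<Longrightarrow> A $$ (j, c) \<noteq> 0 \<Longrightarrow> \<pi> j = \<pi>' j"
  shows "perm_mat N \<pi> * A = perm_mat N \<pi>' * A"
proof (intro eq_matI)
  fix i c assume "i < dim_row (perm_mat N \<pi>' * A)" "c < dim_col (perm_mat N \<pi>' * A)"
  then have ic: "i < 2 ^ N" "c < m" using A by (auto simp: perm_mat_def)
  have "(perm_mat N \<rho> * A) $$ (i, c) = (\<Sum>j<2 ^ N. of_bool (i = \<rho> j) * A $$ (j, c))" for \<rho>
    using ic A by (simp add: mult_index_sum perm_mat_def del: index_mult_mat(1))
  moreover have "(\<Sum>j<2 ^ N. of_bool (i = \<pi> j) * A $$ (j, c)) = (\<Sum>j<2 ^ N. of_bool (i = \<pi>' j) * A $$ (j, c))"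
  proof (intro sum.cong refl)
    fix j assume "j \<in> {..<(2 :: nat) ^ N}"
    then show "of_bool (i = \<pi> j) * A $$ (j, c) = of_bool (i = \<pi>' j) * A $$ (j, c)"
      using eq[of j c] ic by (cases "A $$ (j, c) = 0") auto
  qed
  ultimately show "(perm_mat N \<pi> * A) $$ (i, c) = (perm_mat N \<pi>' * A) $$ (i, c)" by simp
qed (use A in \<open>auto simp: perm_mat_def\<close>)

section \<open>Robustness\<close>

lemma pad_pad:
  assumes "dim_row A \<le> 2 ^ w" "w \<le> N"
  shows "pad N (pad w A) = pad N A"
proof -
  have "(2 :: nat) ^ w \<le> 2 ^ N" using assms(2) by simp
  then show ?thesis using assms(1) by (intro eq_matI) (auto simp: pad_def)
qed

lemma minus_minus_cancel_mat:
  fixes X :: "complex mat"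
  assumes "X \<in> carrier_mat n m" "Y \<in> carrier_mat n m" "Z \<in> carrier_mat n m"
  shows "(X - Z) - (Y - Z) = X - Y"
  using assms by (intro eq_matI) auto

lemma pad_self: "A \<in> carrier_mat (2 ^ N) m \<Longrightarrow> pad N A = A"
  by (intro eq_matI) (auto simp: pad_def)

lemma pad_minus:
  assumes "A \<in> carrier_mat d m" "B \<in> carrier_mat d m"
  shows "pad N (A - B) = pad N A - pad N B"
  using assms by (intro eq_matI) (auto simp: pad_def)

lemma run_circuit_gram:
  assumes "L \<in> carrier_mat (2 ^ k) m" "k \<le> width C"
  shows "run_circuit C k (L * mat_adjoint L)
    = (gates_mat (width C) (gates C) * pad (width C) L) *
      mat_adjoint (gates_mat (width C) (gates C) * pad (width C) L)"
  using assms
  by (simp add: run_circuit_def tensor_zero_state evolve_gram[OF gates_mat_carrier pad_carrier[OF assms(1)]])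

lemma frob_run_circuit:
  assumes "circuit_ok C" "L \<in> carrier_mat (2 ^ k) m" "k \<le> width C"
  shows "frob (gates_mat (width C) (gates C) * pad (width C) L) = frob L"
  using assms
  by (simp add: frob_unitary[OF unitary_gates_mat pad_carrier[OF assms(2)]] circuit_ok_def frob_pad)

lemma zero_state_0_gram: "zero_state 0 = 1\<^sub>m (2 ^ 0) * mat_adjoint (1\<^sub>m (2 ^ 0) :: complex mat)"
  by (intro eq_matI) (auto simp: zero_state_def basis_state_def)

lemma frob_one_mat_1: "frob (1\<^sub>m (2 ^ 0)) = 1"
  by (simp add: frob_def L2_set_def lessThan_Suc)

text \<open>Key generation starts from the one-dimensional state of no wires, whose factor is the
  identity matrix of size 1; the circuit, the measurement and the partial trace all preserve being a
  state.\<close>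

lemma is_state_tdf_kg:
  assumes "tdf_well_formed F" "(ek, td, vk) \<in> set_pmf (tdf_kg F k)"
  shows "is_state (2 ^ td_len F k) td"
proof -
  let ?C = "kg_circ F k"
  have ok: "circuit_ok ?C" "td_len F k \<le> width ?C"
    using assms(1) unfolding tdf_well_formed_def by (meson add_leD1)+
  have "is_state (2 ^ width ?C) (run_circuit ?C 0 (zero_state 0))"
    unfolding zero_state_0_gram is_state_def
    using run_circuit_gram[of "1\<^sub>m (2 ^ 0)" 0 "2 ^ 0" ?C] frob_run_circuit[OF ok(1), of "1\<^sub>m (2 ^ 0)" 0 "2 ^ 0"]
      frob_one_mat_1 mult_carrier_mat[OF gates_mat_carrier pad_carrier[of "1\<^sub>m (2 ^ 0)" "2 ^ 0" "2 ^ 0"]]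
    by (metis one_carrier_mat le0)
  moreover obtain s \<rho> where
    "(s, \<rho>) \<in> set_pmf (measure_wires [td_len F k ..< td_len F k + ek_len F k + vk_len F k + aux_len F k]
      (run_circuit ?C 0 (zero_state 0)))" "td = reduced (td_len F k) \<rho>"
    using assms(2) by (auto simp: tdf_kg_def Let_def)
  ultimately show ?thesis
    using is_state_measure_wires is_state_reduced ok(2) by metis
qed

lemma flip_bit_commute: "flip_bit p (flip_bit q i) = flip_bit q (flip_bit p (i :: nat))"
  by (auto simp: bit_eq_iff bit_flip_bit_iff)

lemma flip_bit_xor: "flip_bit q (i XOR m) = flip_bit q i XOR (m :: nat)"
  by (auto simp: bit_eq_iff bit_simps)

section \<open>Writing and copying the result\<close>

context
  fixes F :: tdf and k :: nat and ek y r :: "bool list" and b :: bool and w :: nat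
  assumes td_dom_le: "td_len F k + dom_len F k \<le> w"
begin

private abbreviation \<pi> where "\<pi> \<equiv> result_perm F k ek (y, r, b) w"

private abbreviation preimage :: "nat \<Rightarrow> bool list" where
  "preimage i \<equiv> map (bit i) [td_len F k ..< td_len F k + dom_len F k]"

lemma result_perm_eq:
  "\<pi> i = (if tdf_eval F k ek (preimage i) = y
    then flip_bit w (if ip (preimage i) r \<noteq> b then flip_bit (w + 1) i else i) else i)"
  by (simp add: result_perm_def Let_def)

lemma result_perm_bit: "q < w \<Longrightarrow> bit (\<pi> i) q = bit i q"
  by (auto simp: result_perm_eq bit_flip_bit_iff)

lemma preimage_cong: "(\<And>q. q < w \<Longrightarrow> bit i q = bit j q) \<Longrightarrow> preimage i = preimage j"
  using td_dom_le by auto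

text \<open>The flips touch only the wires \<open>w\<close> and \<open>w + 1\<close>, while the
  preimage is read below \<open>w\<close>; the second application therefore makes the same decisions
  and undoes the flips.\<close>

lemma result_perm_involution: "\<pi> (\<pi> i) = i"
proof -
  have eq: "preimage (\<pi> i) = preimage i" by (intro preimage_cong result_perm_bit)
  show ?thesis
    unfolding result_perm_eq[of "\<pi> i"] eq
    unfolding result_perm_eq[of i] by (simp add: flip_bit_commute[of _ w])
qed

lemma result_perm_less:
  assumes "w + 1 < N" "i < 2 ^ N"
  shows "\<pi> i < 2 ^ N"
  using assms by (auto simp: result_perm_eq flip_bit_less)

lemma unitary_result_perm: "w + 1 < N \<Longrightarrow> unitary_mat (2 ^ N) (perm_mat N \<pi>)"
  by (intro unitary_perm_mat inj_on_inverseI[where g = \<pi>] result_perm_less result_perm_involution)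

text \<open>A mask on wires from \<open>w\<close> on does not alter the preimage that is read, and
  bit flips commute with adding a mask.\<close>

lemma result_perm_xor:
  assumes "\<And>q. q < w \<Longrightarrow> \<not> bit m q"
  shows "\<pi> (i XOR m) = \<pi> i XOR m"
proof -
  have eq: "preimage (i XOR m) = preimage i"
    using assms by (intro preimage_cong) (simp add: bit_xor_iff)
  show ?thesis
    unfolding result_perm_eq eq by (simp add: flip_bit_xor)
qed

lemma xor_mat_commute_result_perm:
  assumes "m < 2 ^ N" "\<And>q. q < w \<Longrightarrow> \<not> bit m q"
  shows "xor_mat N m * perm_mat N \<pi> = perm_mat N \<pi> * xor_mat N m"
proof (rule xor_mat_commuteI[OF assms(1) perm_mat_carrier])
  fix i j :: nat assume "i < 2 ^ N" "j < 2 ^ N"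
  moreover have "i XOR m = \<pi> j XOR m \<longleftrightarrow> i = \<pi> j" by (metis xor_xor_cancel)
  ultimately show "perm_mat N \<pi> $$ (i XOR m, j XOR m) = perm_mat N \<pi> $$ (i, j)"
    using assms by (simp add: perm_mat_def xor_less result_perm_xor)
qed

text \<open>
  When the result is \<open>e\<close>, copying it acts like adding a constant mask to the copy register, and
  this operation commutes with the unitary that is later uncomputed.
\<close>

private definition result_mask :: "bool option \<Rightarrow> nat" where
  "result_mask e = (case e of None \<Rightarrow> 0
     | Some b' \<Rightarrow> flip_bit (w + 2) (if b' then flip_bit (w + 3) 0 else 0))"

private lemma bit_result_mask:
  "bit (result_mask e) q \<longleftrightarrow> e \<noteq> None \<and> (q = w + 2 \<or> q = w + 3 \<and> e = Some True)"
  by (auto simp: result_mask_def bit_simps split: option.splits)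

private lemma result_mask_less: "result_mask e < 2 ^ (w + 4)"
  by (auto simp: less_power2_iff_bits bit_result_mask)

private lemma copy_mat:
  "gates_mat (w + 4) [CNot w (w + 2), CNot (w + 1) (w + 3)]
    = perm_mat (w + 4) (\<lambda>j. if bit j (w + 1) then flip_bit (w + 3) j else j) *
      perm_mat (w + 4) (\<lambda>j. if bit j w then flip_bit (w + 2) j else j)"
  unfolding gates_mat_def
  by (simp only: fold_simps gate_mat.simps right_mult_one_mat[OF perm_mat_carrier])

text \<open>Since \<open>j\<close> is below \<open>2 ^ w\<close>, the result register starts at 0,
  so after the permutation it holds exactly the encoding of \<open>e\<close>: both wires clear for
  \<bottom>, otherwise the flag and the bit. The two CNots then flip precisely the copy wires set in
  the mask.\<close>

private lemma copy_result:
  assumes "j < 2 ^ w"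
    and "(if tdf_eval F k ek (preimage j) = y then Some (ip (preimage j) r \<noteq> b) else None) = e"
  shows "(let i = \<pi> j; i' = (if bit i w then flip_bit (w + 2) i else i)
      in if bit i' (w + 1) then flip_bit (w + 3) i' else i') = \<pi> j XOR result_mask e"
proof -
  have high: "\<not> bit j q" if "q \<ge> w" for q using assms(1) that by (simp add: less_power2_iff_bits)
  have xor_flip: "i XOR flip_bit q m = flip_bit q (i XOR m)" for i m :: nat and q
    by (auto simp: bit_eq_iff bit_simps)
  show ?thesis
  proof (cases "tdf_eval F k ek (preimage j) = y")
    case True
    then have "e = Some (ip (preimage j) r \<noteq> b)" using assms(2) by simp
    moreover define b' where "b' = (ip (preimage j) r \<noteq> b)"
    moreover have "\<pi> j = flip_bit w (if b' then flip_bit (w + 1) j else j)"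
      unfolding result_perm_eq b'_def using True by (simp only: if_True simp_thms)
    ultimately show ?thesis
      by (cases b') (simp_all add: Let_def high bit_flip_bit_iff result_mask_def xor_flip
          flip_bit_commute[of "w + 3" "Suc (Suc w)"] del: flip_bit_of_0)
  next
    case False
    then have "e = None" using assms(2) by simp
    moreover have "\<pi> j = j" unfolding result_perm_eq using False by (simp only: if_False)
    ultimately show ?thesis by (simp add: Let_def high result_mask_def)
  qed
qed

text \<open>Applying \<open>V\<close> reduces the comparison to \<open>G * B\<close> against
  \<open>C * B\<close>, where \<open>B\<close> is the state just before the copy. On the ideal part
  \<open>B'\<close> both operators agree, so only \<open>B - B'\<close> matters; its norm enters
  once for the mask and once for the copy, whence the factor 2.\<close>

lemma uncomputed_copy_close:
  fixes gs N
  defines "N \<equiv> w + 4"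
  defines "V \<equiv> perm_mat N \<pi> * gates_mat N gs"
  defines "C \<equiv> gates_mat N [CNot w (w + 2), CNot (w + 1) (w + 3)]"
  defines "T \<equiv> mat_adjoint V * C * V"
  assumes gs: "\<forall>g\<in>set gs. gate_ok w g"
    and M: "M \<in> carrier_mat (2 ^ N) m" and Q: "Q \<in> carrier_mat (2 ^ w) m"
    and MQ: "gates_mat N gs * M = pad N Q"
    and Q': "Q' \<in> carrier_mat (2 ^ w) m"
    and e: "\<And>j c. j < 2 ^ w \<Longrightarrow> c < m \<Longrightarrow> Q' $$ (j, c) \<noteq> 0 \<Longrightarrow>
      (if tdf_eval F k ek (preimage j) = y then Some (ip (preimage j) r \<noteq> b) else None) = e"
  obtains mask where "mask < 2 ^ N" "\<And>q. q < w \<Longrightarrow> \<not> bit mask q"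
    "frob (xor_mat N mask * M - T * M) \<le> 2 * frob (Q - Q')" "unitary_mat (2 ^ N) T"
proof -
  let ?n = "2 ^ N :: nat" and ?R = "perm_mat N \<pi>" and ?U = "gates_mat N gs"
  define mask where "mask = result_mask e"
  define G where "G = xor_mat N mask"
  have mask: "mask < ?n" "\<And>q. q < w \<Longrightarrow> \<not> bit mask q"
    using result_mask_less[of e] by (auto simp: mask_def N_def bit_result_mask)
  have R: "unitary_mat ?n ?R" by (intro unitary_result_perm) (simp add: N_def)
  have "\<forall>g\<in>set gs. gate_ok N g" using gs by (auto simp: N_def intro: gate_ok_mono)
  then have U: "unitary_mat ?n ?U" by (rule unitary_gates_mat)
  have V: "unitary_mat ?n V" unfolding V_def by (intro unitary_mat_mult R U)
  have C: "unitary_mat ?n C" unfolding C_def by (intro unitary_gates_mat) (auto simp: N_def)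
  have T: "unitary_mat ?n T"
    unfolding T_def by (intro unitary_mat_mult unitary_mat_adjoint V C)
  have G: "unitary_mat ?n G" unfolding G_def by (rule unitary_xor_mat[OF mask(1)])
  note carr = unitary_matD(1)[OF R] unitary_matD(1)[OF U] unitary_matD(1)[OF V]
    unitary_matD(1)[OF C] unitary_matD(1)[OF T] unitary_matD(1)[OF G]
  note assoc = assoc_mult_mat[of _ ?n ?n _ ?n _ m]
  have pad: "pad N Z \<in> carrier_mat ?n m" if "Z \<in> carrier_mat (2 ^ w) m" for Z
    using that by simp
  have RZ: "?R * Z \<in> carrier_mat ?n m" if "Z \<in> carrier_mat ?n m" for Z
    using mult_carrier_mat[OF carr(1) that] .
  define B B' where "B = ?R * pad N Q" "B' = ?R * pad N Q'"
  note BB = B_B'_def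
  have B: "B \<in> carrier_mat ?n m" "B' \<in> carrier_mat ?n m" unfolding BB by (intro RZ pad Q Q')+
  have VM: "V * M = B" unfolding V_def BB MQ[symmetric] by (rule assoc[OF carr(1,2) M])
  \<comment> \<open>The mask sits above the result register, and everything in \<open>V\<close>
    either acts below \<open>w\<close> or flips result wires, which commutes with a mask.\<close>
  have GV: "G * V = V * G"
    unfolding V_def G_def
    by (intro commute_mult[of _ ?n] xor_mat_commute_result_perm xor_mat_commute_gates[OF gs] mask) auto
  have "V * (G * M) = G * B"
    using assoc[OF carr(3) carr(6) M] assoc[OF carr(6) carr(3) M] by (simp only: GV VM)
  moreover have "V * (T * M) = C * B"
  proof -
    have aV: "mat_adjoint V \<in> carrier_mat ?n ?n" using carr(3) by simp
    have "T * M = mat_adjoint V * (C * (V * M))"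
      unfolding T_def
      by (simp only: assoc[OF mult_carrier_square[OF aV carr(4)] carr(3) M]
          assoc[OF aV carr(4) mult_carrier_mat[OF carr(3) M]])
    then show ?thesis
      using mat_adjoint_cancel(2)[OF V mult_carrier_mat[OF carr(4) B(1)]] by (simp only: VM)
  qed
  ultimately have VXY: "V * (G * M - T * M) = G * B - C * B"
    using mult_minus_distrib_mat[OF carr(3) mult_carrier_mat[OF carr(6) M] mult_carrier_mat[OF carr(5) M]]
    by simp
  \<comment> \<open>Every basis index in the support of \<open>Q'\<close> yields the same result
    \<open>e\<close>, so on this part the two CNots act as one constant mask.\<close>
  have "C * B' = G * B'"
  proof -
    let ?c1 = "\<lambda>j. if bit j w then flip_bit (w + 2) j else j"
    let ?c2 = "\<lambda>j. if bit j (w + 1) then flip_bit (w + 3) j else j"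
    have p: "\<pi> j < ?n" if "j < ?n" for j using that by (intro result_perm_less) (auto simp: N_def)
    have c1: "?c1 j < ?n" if "j < ?n" for j using that by (auto simp: flip_bit_less N_def)
    have "C = perm_mat N ?c2 * perm_mat N ?c1" unfolding C_def N_def by (rule copy_mat)
    then have "C * B' = (perm_mat N ?c2 * (perm_mat N ?c1 * ?R)) * pad N Q'"
      by (simp only: BB assoc[OF perm_mat_carrier perm_mat_carrier RZ[OF pad[OF Q']]]
          assoc[OF perm_mat_carrier perm_mat_carrier pad[OF Q']]
          assoc[OF perm_mat_carrier mult_carrier_square[OF perm_mat_carrier perm_mat_carrier] pad[OF Q']])
    also have "\<dots> = perm_mat N (\<lambda>j. ?c2 (?c1 (\<pi> j))) * pad N Q'"
      using p c1 by (simp add: perm_mat_mult)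
    also have "\<dots> = perm_mat N (\<lambda>j. \<pi> j XOR mask) * pad N Q'"
    proof (rule perm_mat_mult_cong[OF pad[OF Q']])
      fix j c assume "j < ?n" "c < m" "pad N Q' $$ (j, c) \<noteq> 0"
      then have j: "j < 2 ^ w" "Q' $$ (j, c) \<noteq> 0"
        using Q' by (auto simp: pad_def split: if_splits)
      show "?c2 (?c1 (\<pi> j)) = \<pi> j XOR mask"
        using copy_result[OF j(1) e[OF j(1) \<open>c < m\<close> j(2)]] by (simp only: mask_def Let_def)
    qed
    also have "\<dots> = (G * ?R) * pad N Q'"
      using p by (simp add: G_def xor_mat_def perm_mat_mult)
    also have "\<dots> = G * B'"
      unfolding BB using carr pad[OF Q'] by (intro assoc)
    finally show ?thesis .
  qed
  then have "G * (B - B') - C * (B - B') = (G * B - G * B') - (C * B - G * B')"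
    by (simp only: mult_minus_distrib_mat[OF carr(6) B] mult_minus_distrib_mat[OF carr(4) B])
  also have "\<dots> = G * B - C * B"
    using mult_carrier_mat[OF carr(6) B(1)] mult_carrier_mat[OF carr(4) B(1)]
      mult_carrier_mat[OF carr(6) B(2)]
    by (rule minus_minus_cancel_mat)
  finally have "frob (G * M - T * M) = frob (G * (B - B') - C * (B - B'))"
    using frob_unitary[OF V minus_carrier_mat[OF mult_carrier_mat[OF carr(5) M]], of "G * M"] VXY by simp
  also have "\<dots> \<le> frob (G * (B - B')) + frob (C * (B - B'))"
    by (rule frob_diff_le[OF mult_carrier_mat[OF carr(6) minus_carrier_mat[OF B(2)]]
          mult_carrier_mat[OF carr(4) minus_carrier_mat[OF B(2)]]])
  also have "\<dots> = 2 * frob (B - B')"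
    using frob_unitary[OF G minus_carrier_mat[OF B(2)]] frob_unitary[OF C minus_carrier_mat[OF B(2)]]
    by simp
  also have "B - B' = ?R * pad N (Q - Q')"
    using mult_minus_distrib_mat[OF carr(1) pad[OF Q] pad[OF Q']] pad_minus[OF Q Q'] by (simp add: BB)
  also have "frob \<dots> = frob (Q - Q')"
    using frob_unitary[OF R pad[OF minus_carrier_mat[OF Q']]] frob_pad[of "Q - Q'" N] Q'
    by (simp add: N_def)
  finally show thesis using that mask T by (simp add: G_def)
qed

end

section \<open>The key after decryption\<close>

text \<open>The classical key is the same in every branch and pulls out of the expectation, and the
  measured copy is among the wires traced out. What remains of decryption is the unitary
  \<open>T\<close> followed by a partial trace.\<close>

lemma dk_after_dec:
  assumes ct: "parse_ct (dom_len F k) ct = Some (y, r, b)"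
    and L: "L \<in> carrier_mat (2 ^ td_len F k) m" "frob L = 1"
    and w: "w = width (inv_circ F k y)" "td_len F k \<le> w"
    and V: "V = perm_mat (w + 4) (result_perm F k ek (y, r, b) w) * gates_mat (w + 4) (gates (inv_circ F k y))"
    and T: "T = mat_adjoint V * gates_mat (w + 4) [CNot w (w + 2), CNot (w + 1) (w + 3)] * V"
      "unitary_mat (2 ^ (w + 4)) T"
    and Y: "Y = T * pad (w + 4) L"
  shows "dk_after (pke_of_tdf F) k (ek, L * mat_adjoint L) ct
    = tensor (basis_state ek) (reduced (td_len F k) (Y * mat_adjoint Y))"
proof -
  let ?t = "td_len F k" and ?N = "w + 4"
  have Tc: "T \<in> carrier_mat (2 ^ ?N) (2 ^ ?N)" using unitary_matD(1)[OF T(2)] .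
  have Yc: "Y \<in> carrier_mat (2 ^ ?N) m" and Y1: "frob Y = 1"
  proof -
    show "Y \<in> carrier_mat (2 ^ ?N) m" unfolding Y by (rule mult_carrier_mat[OF Tc pad_carrier[OF L(1)]])
    have "(2 :: nat) ^ ?t \<le> 2 ^ ?N" using w(2) by (intro power_increasing) auto
    then show "frob Y = 1"
      unfolding Y using L frob_unitary[OF T(2) pad_carrier[OF L(1)]] by (simp add: frob_pad)
  qed
  have "evolve T (tensor (L * mat_adjoint L) (zero_state (?N - ?t))) = Y * mat_adjoint Y"
    using w(2) Tc unfolding Y
    by (simp add: tensor_zero_state[OF L(1)] evolve_gram[OF Tc pad_carrier[OF L(1)]])
  then have dec: "pke_dec (pke_of_tdf F) k (ek, L * mat_adjoint L) ct
      = map_pmf (\<lambda>(s, \<rho>). (decode_result s, (ek, reduced ?t \<rho>)))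
          (measure_wires [w + 2, w + 3] (Y * mat_adjoint Y))"
    using ct by (simp add: pke_of_tdf_def dec_def Let_def w(1) T(1) V)
  have td: "dim_row (L * mat_adjoint L) = 2 ^ ?t" "dim_col (L * mat_adjoint L) = 2 ^ ?t"
    using L(1) by auto
  show ?thesis
  proof (intro eq_matI)
    fix i j assume "i < dim_row (tensor (basis_state ek) (reduced ?t (Y * mat_adjoint Y)))"
      "j < dim_col (tensor (basis_state ek) (reduced ?t (Y * mat_adjoint Y)))"
    then have ij: "i < 2 ^ length ek * 2 ^ ?t" "j < 2 ^ length ek * 2 ^ ?t"
      by (auto simp: tensor_def basis_state_def reduced_def)
    then have div: "i div 2 ^ length ek < 2 ^ ?t" "j div 2 ^ length ek < 2 ^ ?t"
      by (auto simp: less_mult_imp_div_less mult.commute)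
    let ?e = "basis_state ek $$ (i mod 2 ^ length ek, j mod 2 ^ length ek)"
    have tensor: "tensor (basis_state ek) (reduced ?t \<rho>) $$ (i, j)
        = ?e * reduced ?t \<rho> $$ (i div 2 ^ length ek, j div 2 ^ length ek)" for \<rho>
      using ij by (simp add: tensor_def basis_state_def reduced_def)
    have "dk_after (pke_of_tdf F) k (ek, L * mat_adjoint L) ct $$ (i, j)
        = measure_pmf.expectation (pke_dec (pke_of_tdf F) k (ek, L * mat_adjoint L) ct)
            (\<lambda>(\<mu>, dk'). dk_state dk' $$ (i, j))"
      using ij td by (simp add: dk_after_def dk_state_def tensor_def basis_state_def)
    also have "\<dots> = measure_pmf.expectation (measure_wires [w + 2, w + 3] (Y * mat_adjoint Y))
        (\<lambda>(s, \<rho>). ?e * reduced ?t \<rho> $$ (i div 2 ^ length ek, j div 2 ^ length ek))"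
      unfolding dec by (simp add: case_prod_unfold dk_state_def tensor)
    also have "\<dots> = ?e * measure_pmf.expectation (measure_wires [w + 2, w + 3] (Y * mat_adjoint Y))
        (\<lambda>(s, \<rho>). reduced ?t \<rho> $$ (i div 2 ^ length ek, j div 2 ^ length ek))"
      by (simp add: case_prod_unfold)
    also have "\<dots> = tensor (basis_state ek) (reduced ?t (Y * mat_adjoint Y)) $$ (i, j)"
      using expectation_reduced_measure_wires[OF Yc Y1 _ _ div, of "[w + 2, w + 3]"] w(2)
      by (simp add: tensor)
    finally show "dk_after (pke_of_tdf F) k (ek, L * mat_adjoint L) ct $$ (i, j)
      = tensor (basis_state ek) (reduced ?t (Y * mat_adjoint Y)) $$ (i, j)" .
  qed (use td in \<open>auto simp: dk_after_def dk_state_def tensor_def basis_state_def reduced_def\<close>)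
qed

text \<open>An unparsable ciphertext leaves the key alone. Otherwise a part \<open>Q'\<close> of the
  inversion output with one definite result is singled out, and the real run is compared with the
  mask belonging to that result.\<close>

lemma trace_distance_dk_after:
  assumes wf: "tdf_well_formed F" and td: "is_state (2 ^ td_len F k) td" and "\<epsilon> \<ge> 0"
    and inv: "\<And>x. length x = dom_len F k \<Longrightarrow>
      measure_pmf.prob (tdf_inv F k td (tdf_eval F k ek x)) {(x', td'). x' = x} \<ge> 1 - \<epsilon>"
  shows "trace_distance (dk_state (ek, td)) (dk_after (pke_of_tdf F) k (ek, td) ct) \<le> 2 * sqrt \<epsilon>"
proof -
  let ?t = "td_len F k" and ?n = "dom_len F k"
  obtain m L where L: "L \<in> carrier_mat (2 ^ ?t) m" "frob L = 1" and tdL: "td = L * mat_adjoint L"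
    using td by (auto simp: is_state_def)
  show ?thesis
  proof (cases "parse_ct ?n ct")
    case None
    have after: "dk_after (pke_of_tdf F) k (ek, td) ct = dk_state (ek, td)"
      by (intro eq_matI) (auto simp: dk_after_def pke_of_tdf_def dec_def None)
    have "reduced ?t (L * mat_adjoint L) = L * mat_adjoint L"
      using reduced_pad[OF L(1), of ?t] pad_self[OF L(1)] by simp
    \<comment> \<open>With a single block, that is, no wires traced out, the general bound also
      covers the distance of a state to itself.\<close>
    then have "trace_distance (dk_state (ek, td)) (dk_state (ek, td)) \<le> frob (L - L)"
      using trace_distance_key_le[of L ?t 1 m L ek] L by (simp add: dk_state_def tdL)
    moreover have "frob (L - L) = 0" by (simp add: frob_eq_0)
    ultimately show ?thesis
      unfolding after using real_sqrt_ge_zero[OF \<open>\<epsilon> \<ge> 0\<close>] by linarith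
  next
    case (Some yrb)
    then obtain y r b where ct: "parse_ct ?n ct = Some (y, r, b)" by (cases yrb) auto
    define w where "w = width (inv_circ F k y)"
    define gs where "gs = gates (inv_circ F k y)"
    define N where "N = w + 4"
    have C: "circuit_ok (inv_circ F k y)" "?t + ?n \<le> w"
      using wf by (auto simp: tdf_well_formed_def w_def)
    then have tw: "?t \<le> w" "?t \<le> N" and gs: "\<forall>g\<in>set gs. gate_ok w g"
      by (auto simp: N_def circuit_ok_def gs_def w_def)
    define Q where "Q = gates_mat w gs * pad w L"
    have Q: "Q \<in> carrier_mat (2 ^ w) m" unfolding Q_def using L(1) by (intro mult_carrier_mat[OF gates_mat_carrier] pad_carrier)
    have Q1: "frob Q = 1"
      using frob_run_circuit[OF C(1) L(1)] tw L(2) by (simp add: Q_def gs_def w_def)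
    \<comment> \<open>The four wires beyond the circuit are the result register and its copy; they
      stay at 0 while the inversion circuit runs.\<close>
    have MQ: "gates_mat N gs * pad N L = pad N Q"
    proof -
      have "(2 :: nat) ^ ?t \<le> 2 ^ w" using tw by simp
      then have "pad N L = pad N (pad w L)" using L(1) by (intro pad_pad[symmetric]) (auto simp: N_def)
      then show ?thesis
        using gates_mat_pad[OF gs _ pad_carrier[OF L(1)], of N] by (simp add: Q_def N_def)
    qed
    define bits where "bits i = map (bit i) [?t ..< ?t + ?n]" for i :: nat
    obtain Q' e where Q': "Q' \<in> carrier_mat (2 ^ w) m" and close: "frob (Q - Q') \<le> sqrt \<epsilon>"
      and e: "\<And>j c. j < 2 ^ w \<Longrightarrow> c < m \<Longrightarrow> Q' $$ (j, c) \<noteq> 0 \<Longrightarrow>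
        (if tdf_eval F k ek (bits j) = y then Some (ip (bits j) r \<noteq> b) else None) = e"
    \<comment> \<open>\<open>Q'\<close> is the projection onto outcome \<open>x\<close> for a
      preimage \<open>x\<close> of \<open>y\<close>, or all of \<open>Q\<close> if there is none.
      Several preimages are no obstacle, as any one of them may be chosen.\<close>
    proof (cases "\<exists>x. length x = ?n \<and> tdf_eval F k ek x = y")
      case True
      then obtain x where x: "length x = ?n" "tdf_eval F k ek x = y" by blast
      let ?P = "outcome_proj (2 ^ w) [?t ..< ?t + ?n] x"
      have "tdf_inv F k td y = map_pmf (\<lambda>(x, \<rho>). (x, reduced ?t \<rho>))
          (measure_wires [?t ..< ?t + ?n] (Q * mat_adjoint Q))"
        using run_circuit_gram[OF L(1)] tw by (simp add: tdf_inv_def Let_def tdL Q_def gs_def w_def)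
      then have "measure_pmf.prob (tdf_inv F k td y) {(x', td'). x' = x}
          = measure_pmf.prob (measure_wires [?t ..< ?t + ?n] (Q * mat_adjoint Q)) {(x', \<rho>). x' = x}"
        by (simp add: vimage_def case_prod_unfold)
      also have "\<dots> = (frob (?P * Q))\<^sup>2" by (rule prob_measure_wires[OF Q Q1])
      finally have "(frob (?P * Q))\<^sup>2 \<ge> 1 - \<epsilon>" using inv[OF x(1)] x(2) by simp
      \<comment> \<open>Total weight 1 and weight at least 1 - \<epsilon> on the outcome leave at
        most \<epsilon> for the complement.\<close>
      then have "(frob (Q - ?P * Q))\<^sup>2 \<le> \<epsilon>"
        using frob_outcome_proj_split[OF Q, of "[?t ..< ?t + ?n]" x] Q1 by simp
      then have "frob (Q - ?P * Q) \<le> sqrt \<epsilon>" by (rule real_le_rsqrt)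
      moreover have "bits j = x" if "j < 2 ^ w" "c < m" "(?P * Q) $$ (j, c) \<noteq> 0" for j c
        using that by (simp add: outcome_proj_mult[OF Q] bits_def split: if_splits)
      moreover have "?P * Q \<in> carrier_mat (2 ^ w) m" using Q by (intro mult_carrier_mat[OF outcome_proj_carrier])
      ultimately show thesis using that[of "?P * Q" "Some (ip x r \<noteq> b)"] x(2) by auto
    next
      case False
      then have "tdf_eval F k ek (bits j) \<noteq> y" for j by (auto simp: bits_def)
      moreover have "frob (Q - Q) = 0" by (simp add: frob_eq_0)
      ultimately show thesis using that[OF Q, of None] \<open>\<epsilon> \<ge> 0\<close> by simp
    qed
    define V where "V = perm_mat N (result_perm F k ek (y, r, b) w) * gates_mat N gs"
    define T where "T = mat_adjoint V * gates_mat N [CNot w (w + 2), CNot (w + 1) (w + 3)] * V"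
    have "\<exists>mask<2 ^ N. (\<forall>q<w. \<not> bit mask q) \<and>
        frob (xor_mat N mask * pad N L - T * pad N L) \<le> 2 * frob (Q - Q') \<and> unitary_mat (2 ^ N) T"
      unfolding T_def V_def N_def
      by (rule uncomputed_copy_close[OF C(2) gs pad_carrier[OF L(1)] Q MQ[unfolded N_def] Q'
            e[unfolded bits_def]]) (assumption | blast)+
    then obtain mask where mask: "mask < 2 ^ N" "\<And>q. q < w \<Longrightarrow> \<not> bit mask q"
      and XY: "frob (xor_mat N mask * pad N L - T * pad N L) \<le> 2 * frob (Q - Q')"
      and T: "unitary_mat (2 ^ N) T"
      by blast
    let ?X = "xor_mat N mask * pad N L" and ?Y = "T * pad N L"
    have N: "(2 :: nat) ^ N = 2 ^ ?t * 2 ^ (N - ?t)" using tw(2) by (simp flip: power_add)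
    have M1: "frob (pad N L) = 1" using L N by (simp add: frob_pad)
    have X: "?X \<in> carrier_mat (2 ^ ?t * 2 ^ (N - ?t)) m" "frob ?X \<le> 1"
      using mult_carrier_mat[OF xor_mat_carrier pad_carrier[OF L(1)], of N mask] N
        frob_unitary[OF unitary_xor_mat[OF mask(1)] pad_carrier[OF L(1)]] M1 by simp_all
    have Y: "?Y \<in> carrier_mat (2 ^ ?t * 2 ^ (N - ?t)) m" "frob ?Y \<le> 1"
      using mult_carrier_mat[OF unitary_matD(1)[OF T] pad_carrier[OF L(1)]] N
        frob_unitary[OF T pad_carrier[OF L(1)]] M1 by simp_all
    \<comment> \<open>The mask acts on wires from \<open>w\<close> on, all of which are traced out,
      so the masked factor still represents the undisturbed trapdoor.\<close>
    have "reduced ?t (?X * mat_adjoint ?X) = td"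
      using reduced_xor_mat[OF tw(2) mask(1) _ pad_carrier[OF L(1)]] mask(2) tw(1)
        reduced_pad[OF L(1) tw(2)] by (simp add: tdL)
    then have before: "dk_state (ek, td) = tensor (basis_state ek) (reduced ?t (?X * mat_adjoint ?X))"
      by (simp add: dk_state_def)
    have after: "dk_after (pke_of_tdf F) k (ek, td) ct = tensor (basis_state ek) (reduced ?t (?Y * mat_adjoint ?Y))"
      unfolding tdL using dk_after_dec[OF ct L w_def tw(1) _ _ T[unfolded N_def]]
      unfolding T_def V_def N_def gs_def by blast
    have "trace_distance (dk_state (ek, td)) (dk_after (pke_of_tdf F) k (ek, td) ct) \<le> frob (?X - ?Y)"
      unfolding before after by (rule trace_distance_key_le[OF X(1) Y(1) X(2) Y(2)])
    also have "\<dots> \<le> 2 * sqrt \<epsilon>" using XY close by simp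
    finally show ?thesis .
  qed
qed

text \<open>The square root halves the exponent of the decay, so \<open>2 * (c + 1)\<close> is used
  for \<open>c\<close>; the spare factor \<open>real k\<close> absorbs the constant 2 once
  \<open>k\<close> is at least 2. The absolute value covers negative values, which
  \<open>negligible\<close> permits.\<close>

lemma negligible_sqrt:
  assumes "negligible \<epsilon>"
  shows "negligible (\<lambda>k. 2 * sqrt \<bar>\<epsilon> k\<bar>)"
  unfolding negligible_def
proof
  fix c :: nat
  have "\<forall>\<^sub>F k in sequentially. \<bar>\<epsilon> k\<bar> < 1 / real k ^ (2 * (c + 1))"
    using assms by (simp only: negligible_def)
  then show "\<forall>\<^sub>F k in sequentially. \<bar>2 * sqrt \<bar>\<epsilon> k\<bar>\<bar> < 1 / real k ^ c"
    using eventually_ge_at_top[of 2]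
  proof eventually_elim
    case (elim k)
    have "sqrt \<bar>\<epsilon> k\<bar> < sqrt (1 / real k ^ (2 * (c + 1)))" using elim by simp
    also have "\<dots> = 1 / real k ^ (c + 1)"
      by (simp only: power_mult real_sqrt_divide real_sqrt_one mult.commute[of 2] real_sqrt_abs) simp
    finally have "2 * sqrt \<bar>\<epsilon> k\<bar> < 2 / real k ^ (c + 1)" by simp
    also have "\<dots> \<le> real k / real k ^ (c + 1)" using elim by (intro divide_right_mono) auto
    also have "\<dots> = 1 / real k ^ c" using elim by simp
    finally show ?case by simp
  qed
qed

theorem lemma4p18:
  fixes F :: tdf
  assumes "tdf_skl F"
  shows "robust (pke_of_tdf F)"
proof -
  have wf: "tdf_well_formed F" and "inversion_correct F"
    using assms by (auto simp: tdf_skl_def)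
  then obtain \<epsilon> \<delta> where \<epsilon>: "negligible \<epsilon>" and \<delta>: "negligible \<delta>"
    and inv: "\<And>k. measure_pmf.prob (tdf_kg F k) {(ek, td, vk). \<forall>x. length x = dom_len F k \<longrightarrow>
        measure_pmf.prob (tdf_inv F k td (tdf_eval F k ek x)) {(x', td'). x' = x} \<ge> 1 - \<epsilon> k} \<ge> 1 - \<delta> k"
    unfolding inversion_correct_def by blast
  have "measure_pmf.prob (pke_kg (pke_of_tdf F) k)
      {(ek, dk, vk). \<forall>ct. trace_distance (dk_state dk) (dk_after (pke_of_tdf F) k dk ct) \<le> 2 * sqrt \<bar>\<epsilon> k\<bar>}
      \<ge> 1 - \<delta> k" for k
  proof -
    let ?I = "{(ek, td, vk). \<forall>x. length x = dom_len F k \<longrightarrow>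
        measure_pmf.prob (tdf_inv F k td (tdf_eval F k ek x)) {(x', td'). x' = x} \<ge> 1 - \<epsilon> k}"
    let ?R = "{(ek, dk, vk). \<forall>ct. trace_distance (dk_state dk) (dk_after (pke_of_tdf F) k dk ct) \<le> 2 * sqrt \<bar>\<epsilon> k\<bar>}"
    let ?f = "\<lambda>(ek, td, vk). (ek, (ek, td), vk)"
    have kg: "pke_kg (pke_of_tdf F) k = map_pmf ?f (tdf_kg F k)"
      by (simp add: pke_of_tdf_def kg_def map_pmf_def case_prod_unfold)
    \<comment> \<open>Only keys in the support are known to be states, so the inclusion of events is
      shown there; the complement has probability 0.\<close>
    have "?I \<inter> set_pmf (tdf_kg F k) \<subseteq> ?f -` ?R"
    proof safe
      fix ek td vk
      assume key: "(ek, td, vk) \<in> set_pmf (tdf_kg F k)"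
        and inv: "\<forall>x. length x = dom_len F k \<longrightarrow>
          measure_pmf.prob (tdf_inv F k td (tdf_eval F k ek x)) {(x', td'). x' = x} \<ge> 1 - \<epsilon> k"
      have "trace_distance (dk_state (ek, td)) (dk_after (pke_of_tdf F) k (ek, td) ct) \<le> 2 * sqrt \<bar>\<epsilon> k\<bar>" for ct
      proof (rule trace_distance_dk_after[OF wf is_state_tdf_kg[OF wf key]])
        fix x :: "bool list" assume "length x = dom_len F k"
        with inv have "1 - \<epsilon> k \<le> measure_pmf.prob (tdf_inv F k td (tdf_eval F k ek x)) {(x', td'). x' = x}"
          by blast
        \<comment> \<open>Passing to the absolute value only weakens the guarantee and ensures a
          nonnegative argument of the square root.\<close>
        then show "1 - \<bar>\<epsilon> k\<bar> \<le> measure_pmf.prob (tdf_inv F k td (tdf_eval F k ek x)) {(x', td'). x' = x}"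
          by simp
      qed simp
      then show "(ek, td, vk) \<in> ?f -` ?R" by simp
    qed
    then have "measure_pmf.prob (tdf_kg F k) ?I \<le> measure_pmf.prob (tdf_kg F k) (?f -` ?R)"
      by (subst measure_Int_set_pmf[symmetric]) (intro measure_pmf.finite_measure_mono, auto)
    then show ?thesis using inv[of k] by (simp add: kg)
  qed
  then show ?thesis
    unfolding robust_def using negligible_sqrt[OF \<epsilon>] \<delta> by blast
qed

end
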